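(* Let $n\ge 1$ and let $\Omega=\mathbb{C}[x_1,\dots,x_n]\otimes\wedge\mathbb{C}^n$ be the algebra of polynomial differential forms on $\mathbb{C}^n$. Let $\mathcal{I}$ be the ideal of $\Omega$ generated by $p_1,\dots,p_n,dp_1,\dots,dp_n$, where $p_j=\sum_{i=1}^n x_i^j$ and $d$ is the exterior derivative. For $l,k\ge 0$ let $\Omega^{l,k}$ be the space of forms $\sum_{1\le i_1<\dots<i_k\le n}f_{i_1\dots i_k}\,dx_{i_1}\wedge\cdots\wedge dx_{i_k}$ with each $f_{i_1\dots i_k}$ homogeneous of degree $l$. Then for $0\le k\le n$: if $\omega\in\Omega^{l,k}$ and $l>\binom{n}{2}-\binom{k+1}{2}$, then $\omega\in\mathcal{I}$. Furthermore, for $0\le k\le n-1$, the image of $\Omega^{\binom n2-\binom{k+1}2,k}$ in $\Omega/\mathcal{I}$ is non-zero. *)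

theory Defs
  imports Complex_Main "HOL-Library.Poly_Mapping"
begin

text \<open>Polynomial differential forms on C^n. Variables are x_0,...,x_(n-1) (0-based).
A form is a coefficient function on basis elements (m, S): the monomial x^m
(exponent vector m, finitely supported) times dx_S = dx_(i_1) wedge ... wedge dx_(i_k)
with i_1 < ... < i_k the elements of S.\<close>

type_synonym form = "(nat \<Rightarrow>\<^sub>0 nat) \<times> nat set \<Rightarrow> complex"

definition Omega :: "nat \<Rightarrow> form set" where
  "Omega n = {\<omega>. finite {b. \<omega> b \<noteq> 0} \<and>
     (\<forall>m S. \<omega> (m, S) \<noteq> 0 \<longrightarrow> Poly_Mapping.keys m \<subseteq> {..<n} \<and> S \<subseteq> {..<n})}"

definition fadd :: "form \<Rightarrow> form \<Rightarrow> form" where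
  "fadd \<omega> \<eta> = (\<lambda>b. \<omega> b + \<eta> b)"

text \<open>Sign of dx_S1 wedge dx_S2 relative to dx_(S1 \<union> S2) (for disjoint S1, S2).\<close>
definition wsign :: "nat set \<Rightarrow> nat set \<Rightarrow> complex" where
  "wsign S1 S2 = (-1) ^ card {(i, j). i \<in> S1 \<and> j \<in> S2 \<and> j < i}"

definition wedge :: "form \<Rightarrow> form \<Rightarrow> form" where
  "wedge \<omega> \<eta> = (\<lambda>(m, S).
     \<Sum>P \<in> {((m1, S1), (m2, S2)). m1 + m2 = m \<and> S1 \<union> S2 = S \<and> S1 \<inter> S2 = {}}.
       (case P of ((m1, S1), (m2, S2)) \<Rightarrow> wsign S1 S2 * \<omega> (m1, S1) * \<eta> (m2, S2)))"

text \<open>Exterior derivative: d(c x^m' dx_T) = sum_i c m'_i x^(m' - e_i) dx_i wedge dx_T.\<close>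
definition ext_d :: "form \<Rightarrow> form" where
  "ext_d \<omega> = (\<lambda>(m, S). \<Sum>i\<in>S.
      wsign {i} (S - {i}) * of_nat (Poly_Mapping.lookup m i + 1) * \<omega> (m + Poly_Mapping.single i 1, S - {i}))"

text \<open>Power sum p_j = x_0^j + ... + x_(n-1)^j (for j \<ge> 1).\<close>
definition psum :: "nat \<Rightarrow> nat \<Rightarrow> form" where
  "psum n j = (\<lambda>(m, S). if S = {} \<and> m \<in> {Poly_Mapping.single i j | i. i < n} then 1 else 0)"

inductive_set gen_ideal :: "nat \<Rightarrow> form set \<Rightarrow> form set" for n G where
  gen: "g \<in> G \<Longrightarrow> a \<in> Omega n \<Longrightarrow> b \<in> Omega n \<Longrightarrow> wedge (wedge a g) b \<in> gen_ideal n G"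
| add: "x \<in> gen_ideal n G \<Longrightarrow> y \<in> gen_ideal n G \<Longrightarrow> fadd x y \<in> gen_ideal n G"

definition Iideal :: "nat \<Rightarrow> form set" where
  "Iideal n = gen_ideal n ({psum n j | j. 1 \<le> j \<and> j \<le> n} \<union> {ext_d (psum n j) | j. 1 \<le> j \<and> j \<le> n})"

definition mdeg :: "(nat \<Rightarrow>\<^sub>0 nat) \<Rightarrow> nat" where
  "mdeg m = (\<Sum>i\<in>Poly_Mapping.keys m. Poly_Mapping.lookup m i)"

definition Omega_lk :: "nat \<Rightarrow> nat \<Rightarrow> nat \<Rightarrow> form set" where
  "Omega_lk n l k = {\<omega> \<in> Omega n. \<forall>m S. \<omega> (m, S) \<noteq> 0 \<longrightarrow> mdeg m = l \<and> card S = k}"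

end

theory Submission
  imports Defs "HOL-Computational_Algebra.Formal_Power_Series"
begin

text \<open>Upper bound. Write \<open>h\<^sub>m(A)\<close> for the complete homogeneous symmetric polynomial in the variables
  indexed by \<open>A\<close>. The ideal contains \<open>h\<^sub>m(A)\<close> and \<open>d h\<^sub>m(A)\<close> for \<open>n - |A| < m \<le> n\<close>. Let \<open>|S| = k\<close>. Wedging
  \<open>d h\<^bsub>n-k+1\<^esub>(S)\<close> with \<open>dx\<^bsub>S-{s}\<^esub>\<close> shows that all partial derivatives \<open>\<partial>\<^sub>s h\<^bsub>n-k+1\<^esub>(S)\<close> annihilate
  \<open>dx\<^sub>S\<close>. They are \<open>k\<close> forms of degree \<open>n-k\<close> in \<open>k\<close> variables without a common zero, so every polynomial
  in these variables of degree above \<open>k(n-k-1)\<close> annihilates \<open>dx\<^sub>S\<close>. Adjoining the remaining variables one by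
  one, Artin's reduction by \<open>h\<^bsub>n-j+1\<^esub>\<close> of \<open>j\<close> variables raises the bound by \<open>n-j\<close> for \<open>j = k+1, \<dots>, n\<close>,
  and the total is \<open>(n choose 2) - (k+1 choose 2)\<close>.

  Lower bound. Contraction with \<open>\<Sum>\<^sub>i x\<^sub>i\<^sup>a \<partial>\<^sub>i\<close>, \<open>a \<ge> 1\<close>, anticommutes with \<open>dp\<^sub>j\<close> up to a multiple of a power
  sum, so contracting with \<open>a = 1, \<dots>, k\<close> maps the \<open>k\<close>-forms of the ideal to the ideal of polynomials generated
  by the power sums. The signed sum of the coefficients at the monomials whose exponents are a rearrangement of
  \<open>0, \<dots>, n-1\<close> kills that ideal, but not the contraction of the
  witness \<open>(\<Prod>\<^bsub>k < p < n\<^esub> x\<^sub>p\<^sup>p) dx\<^sub>0 \<dots> dx\<^bsub>k-1\<^esub>\<close>.\<close>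


subsection \<open>Complete homogeneous symmetric polynomials\<close>

definition geom_fps :: "'a::comm_ring_1 \<Rightarrow> 'a fps" where
  "geom_fps a = Abs_fps (\<lambda>i. a ^ i)"

text \<open>The generating function of the h_m is the product of the 1/(1 - x_s X); the recursions
  and Newton's identity below compare its coefficients.\<close>

definition hsym :: "('i \<Rightarrow> 'a::comm_ring_1) \<Rightarrow> 'i set \<Rightarrow> nat \<Rightarrow> 'a" where
  "hsym x A m = fps_nth (\<Prod>s\<in>A. geom_fps (x s)) m"

text \<open>The derivative of \<^term>\<open>hsym x A (Suc m)\<close> with respect to \<^term>\<open>x s\<close>, obtained from
  \<open>\<partial>/\<partial>a (1/(1 - a y)) = y/(1 - a y)\<^sup>2\<close>.\<close>
definition hsymd :: "('i \<Rightarrow> 'a::comm_ring_1) \<Rightarrow> 'i set \<Rightarrow> 'i \<Rightarrow> nat \<Rightarrow> 'a" where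
  "hsymd x A s m = fps_nth (geom_fps (x s) * (\<Prod>s\<in>A. geom_fps (x s))) m"

lemma geom_fps_unfold: "geom_fps a = 1 + fps_X * (fps_const a * geom_fps a)"
proof (rule fps_ext)
  fix n show "fps_nth (geom_fps a) n = fps_nth (1 + fps_X * (fps_const a * geom_fps a)) n"
    by (cases n) (simp_all add: geom_fps_def fps_X_mult_nth)
qed

text \<open>Multiplication by 1/(1 - a X) solves F = f + a X F. This one coefficient comparison
  yields all recursions for \<open>hsym\<close> and \<open>hsymd\<close>.\<close>

lemma fps_nth_geom_mult_Suc:
  "fps_nth (geom_fps a * f) (Suc m) = fps_nth f (Suc m) + a * fps_nth (geom_fps a * f) m"
proof -
  have "geom_fps a * f = f + fps_X * (fps_const a * (geom_fps a * f))"
    by (subst geom_fps_unfold) (simp add: algebra_simps)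
  then have "fps_nth (geom_fps a * f) (Suc m)
      = fps_nth (f + fps_X * (fps_const a * (geom_fps a * f))) (Suc m)" by simp
  then show ?thesis by (simp add: fps_X_mult_nth)
qed

lemma hsym_0 [simp]: "hsym x A 0 = 1"
  by (induction A rule: infinite_finite_induct) (auto simp: hsym_def geom_fps_def)

lemma hsymd_0 [simp]: "hsymd x A s 0 = 1"
  using hsym_0[of x A] by (simp add: hsym_def hsymd_def geom_fps_def)

lemma hsym_empty [simp]: "hsym x {} (Suc m) = 0"
  by (simp add: hsym_def)

lemma hsym_insert:
  "finite A \<Longrightarrow> t \<notin> A \<Longrightarrow> hsym x (insert t A) (Suc m) = hsym x A (Suc m) + x t * hsym x (insert t A) m"
  by (simp add: hsym_def fps_nth_geom_mult_Suc)

lemma hsymd_Suc: "hsymd x A s (Suc m) = hsym x A (Suc m) + x s * hsymd x A s m"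
  by (simp add: hsym_def hsymd_def fps_nth_geom_mult_Suc)

lemma hsymd_insert:
  assumes "finite A" "t \<notin> A"
  shows "hsymd x (insert t A) s (Suc m) = hsymd x A s (Suc m) + x t * hsymd x (insert t A) s m"
proof -
  have "geom_fps (x s) * (\<Prod>s\<in>insert t A. geom_fps (x s))
      = geom_fps (x t) * (geom_fps (x s) * (\<Prod>s\<in>A. geom_fps (x s)))"
    using assms by (simp add: mult_ac)
  then show ?thesis by (simp add: hsymd_def fps_nth_geom_mult_Suc)
qed

text \<open>\<open>hsymd\<close> carries one extra factor 1/(1 - x_s X), whose coefficients are the
  powers of x_s.\<close>

lemma hsymd_eq_sum: "hsymd x A s m = (\<Sum>i\<le>m. x s ^ i * hsym x A (m - i))"
proof (induction m)
  case (Suc m)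
  have "(\<Sum>i\<le>Suc m. x s ^ i * hsym x A (Suc m - i))
      = hsym x A (Suc m) + (\<Sum>i\<le>m. x s ^ Suc i * hsym x A (m - i))"
    by (subst sum.atMost_Suc_shift) simp
  then show ?case by (simp add: hsymd_Suc Suc.IH sum_distrib_left mult_ac)
qed simp

text \<open>For t outside A the extra factor of \<open>hsymd x A t\<close> is just the factor
  contributed by t. The result is monic in x_t over the variables of A, as Artin's reduction
  requires.\<close>

lemma hsym_insert_expand:
  assumes "finite A" "t \<notin> A"
  shows "hsym x (insert t A) m = (\<Sum>i\<le>m. x t ^ i * hsym x A (m - i))"
  using assms by (simp add: hsymd_eq_sum[symmetric]) (simp add: hsym_def hsymd_def)

lemma fps_deriv_geom: "fps_deriv (geom_fps a) = fps_const a * (geom_fps a * geom_fps a)"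
proof (rule fps_ext)
  fix n
  have "fps_nth (geom_fps a * geom_fps a) n = of_nat (Suc n) * a ^ n"
    by (simp add: fps_mult_nth geom_fps_def power_add[symmetric])
  then show "fps_nth (fps_deriv (geom_fps a)) n = fps_nth (fps_const a * (geom_fps a * geom_fps a)) n"
    by (simp add: geom_fps_def mult_ac)
qed

lemma fps_deriv_prod_geom:
  "finite A \<Longrightarrow> fps_deriv (\<Prod>s\<in>A. geom_fps (x s))
     = (\<Sum>s\<in>A. fps_const (x s) * (geom_fps (x s) * (\<Prod>s\<in>A. geom_fps (x s))))"
proof (induction A rule: finite_induct)
  case (insert t A)
  show ?case using insert
    by (simp add: fps_deriv_geom sum_distrib_left sum_distrib_right algebra_simps)
qed simp

text \<open>Logarithmic differentiation of the generating function: 1/(1 - x_s X) has derivative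
  x_s/(1 - x_s X)^2, and the derivative of the product has (m+1) h_{m+1} as coefficient of
  X^m.\<close>

lemma hsym_euler:
  assumes "finite A"
  shows "(\<Sum>s\<in>A. x s * hsymd x A s m) = of_nat (Suc m) * hsym x A (Suc m)"
proof -
  have "fps_nth (fps_deriv (\<Prod>s\<in>A. geom_fps (x s))) m = (\<Sum>s\<in>A. x s * hsymd x A s m)"
    using assms by (simp add: fps_deriv_prod_geom hsymd_def fps_sum_nth)
  then show ?thesis by (simp add: hsym_def)
qed

text \<open>Expanding the Euler terms in powers of x_s and summing over s first turns these powers
  into power sums.\<close>

lemma hsym_newton:
  assumes "finite A"
  shows "of_nat (Suc m) * hsym x A (Suc m) = (\<Sum>i\<le>m. (\<Sum>s\<in>A. x s ^ Suc i) * hsym x A (m - i))"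
proof -
  have "(\<Sum>s\<in>A. x s * hsymd x A s m) = (\<Sum>s\<in>A. \<Sum>i\<le>m. x s ^ Suc i * hsym x A (m - i))"
    by (simp add: hsymd_eq_sum sum_distrib_left mult_ac)
  also have "\<dots> = (\<Sum>i\<le>m. (\<Sum>s\<in>A. x s ^ Suc i) * hsym x A (m - i))"
    by (subst sum.swap) (simp add: sum_distrib_right)
  finally show ?thesis using hsym_euler[OF assms, of x m] by simp
qed

subsection \<open>Polynomials\<close>

type_synonym cpoly = "(nat \<Rightarrow>\<^sub>0 nat) \<Rightarrow>\<^sub>0 complex"

definition Xv :: "nat \<Rightarrow> cpoly" where
  "Xv i = Poly_Mapping.single (Poly_Mapping.single i 1) 1"

abbreviation Cst :: "complex \<Rightarrow> cpoly" where
  "Cst c \<equiv> Poly_Mapping.single 0 c"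

lemma X_power: "Xv i ^ j = Poly_Mapping.single (Poly_Mapping.single i j) 1"
  by (induction j) (simp_all add: Xv_def mult_single single_add[symmetric])

lemma Cst_inverse_cancel:
  assumes "c \<noteq> 0" shows "Cst (inverse c) * (Cst c * f) = f"
proof -
  have "Cst (inverse c) * (Cst c * f) = (Cst (inverse c) * Cst c) * f" by (simp add: mult.assoc)
  then show ?thesis using assms by (simp add: mult_single)
qed

lemma of_nat_eq_Cst: "(of_nat k :: cpoly) = Cst (of_nat k)"
  by simp

lemma cpoly_induct [case_names single add]:
  assumes s: "\<And>m c. P (Poly_Mapping.single m c)" and a: "\<And>f g. P f \<Longrightarrow> P g \<Longrightarrow> P (f + g)"
  shows "P (f :: 'b \<Rightarrow>\<^sub>0 'c::comm_monoid_add)"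
proof -
  have "finite A \<Longrightarrow> P (\<Sum>m\<in>A. Poly_Mapping.single m (Poly_Mapping.lookup f m))" for A
  proof (induction A rule: finite_induct)
    case empty show ?case using s[of _ 0] by simp
  qed (auto intro: s a)
  moreover have "f = (\<Sum>m\<in>Poly_Mapping.keys f. Poly_Mapping.single m (Poly_Mapping.lookup f m))"
    by (rule poly_mapping_eqI)
      (auto simp: lookup_sum lookup_single when_def in_keys_iff sum.delta)
  ultimately show ?thesis using finite_keys by metis
qed

definition vars_in :: "nat \<Rightarrow> cpoly set" where
  "vars_in n = {f. \<forall>m\<in>Poly_Mapping.keys f. Poly_Mapping.keys m \<subseteq> {..<n}}"

lemma vars_in_single: "Poly_Mapping.keys m \<subseteq> {..<n} \<Longrightarrow> Poly_Mapping.single m c \<in> vars_in n"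
  by (auto simp: vars_in_def)

lemma vars_in_X: "i < n \<Longrightarrow> Xv i \<in> vars_in n"
  unfolding Xv_def by (rule vars_in_single) simp

lemma vars_in_Cst: "Cst c \<in> vars_in n"
  by (rule vars_in_single) simp

lemma vars_in_0 [simp]: "0 \<in> vars_in n" and vars_in_1 [simp]: "1 \<in> vars_in n"
  by (auto simp: vars_in_def)

lemma vars_in_add: "f \<in> vars_in n \<Longrightarrow> g \<in> vars_in n \<Longrightarrow> f + g \<in> vars_in n"
  unfolding vars_in_def using keys_add[of f g] by blast

lemma vars_in_mult: 
  assumes "f \<in> vars_in n" "g \<in> vars_in n" shows "f * g \<in> vars_in n"
  unfolding vars_in_def
proof (intro CollectI ballI)
  fix m assume "m \<in> Poly_Mapping.keys (f * g)"
  then obtain a b where m: "m = a + b" "a \<in> Poly_Mapping.keys f" "b \<in> Poly_Mapping.keys g"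
    using keys_mult[of f g] by blast
  then show "Poly_Mapping.keys m \<subseteq> {..<n}"
    using assms keys_add[of a b] by (fastforce simp: vars_in_def)
qed

lemma vars_in_power: "f \<in> vars_in n \<Longrightarrow> f ^ j \<in> vars_in n"
  by (induction j) (auto intro: vars_in_mult)

lemma vars_in_sum: "(\<And>i. i \<in> A \<Longrightarrow> f i \<in> vars_in n) \<Longrightarrow> sum f A \<in> vars_in n"
  by (induction A rule: infinite_finite_induct) (auto intro: vars_in_add)

section \<open>Formal partial derivatives\<close>

text \<open>Truncated subtraction of exponent vectors is harmless: where it truncates, x_i has
  exponent 0 and the coefficient vanishes.\<close>

definition pderivm :: "nat \<Rightarrow> cpoly \<Rightarrow> cpoly" where
  "pderivm i f = (\<Sum>m\<in>Poly_Mapping.keys f.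
     Poly_Mapping.single (m - Poly_Mapping.single i 1) (of_nat (Poly_Mapping.lookup m i) * Poly_Mapping.lookup f m))"

lemma pderivm_superset:
  assumes "finite A" "Poly_Mapping.keys f \<subseteq> A"
  shows "pderivm i f = (\<Sum>m\<in>A.
     Poly_Mapping.single (m - Poly_Mapping.single i 1) (of_nat (Poly_Mapping.lookup m i) * Poly_Mapping.lookup f m))"
  unfolding pderivm_def using assms by (intro sum.mono_neutral_left) (auto simp: in_keys_iff)

lemma pderivm_single:
  "pderivm i (Poly_Mapping.single m c)
     = Poly_Mapping.single (m - Poly_Mapping.single i 1) (of_nat (Poly_Mapping.lookup m i) * c)"
  by (subst pderivm_superset[of "{m}"]) auto

lemma pderivm_add: "pderivm i (f + g) = pderivm i f + pderivm i g"
proof -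
  let ?A = "Poly_Mapping.keys f \<union> Poly_Mapping.keys g"
  show ?thesis
    using keys_add[of f g]
    by (simp add: pderivm_superset[of ?A] lookup_add single_add distrib_left sum.distrib)
qed

lemma pderivm_0 [simp]: "pderivm i 0 = 0"
  by (simp add: pderivm_def)

lemma pderivm_1 [simp]: "pderivm i 1 = 0"
  using pderivm_single[of i 0 1] by simp

lemma pderivm_sum: "pderivm i (sum f A) = (\<Sum>a\<in>A. pderivm i (f a))"
  by (induction A rule: infinite_finite_induct) (auto simp: pderivm_add)

lemma diff_single_add:
  assumes "Poly_Mapping.lookup m i \<noteq> (0::nat)"
  shows "m - Poly_Mapping.single i 1 + k = m + k - Poly_Mapping.single i 1"
  using assms by (intro poly_mapping_eqI) (auto simp: lookup_add lookup_minus lookup_single when_def)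

lemma pderivm_mult: "pderivm i (f * g) = pderivm i f * g + f * pderivm i g"
proof (induction f rule: cpoly_induct)
  case (single m c)
  show ?case
  proof (induction g rule: cpoly_induct)
    case (single k e)
    let ?e = "Poly_Mapping.single i (1::nat)"
    \<comment> \<open>Lowering the exponent of x_i before or after multiplying agrees unless that
      exponent is 0, and then the coefficient is 0.\<close>
    have 1: "Poly_Mapping.single (m - ?e + k) (of_nat (Poly_Mapping.lookup m i) * c * e)
      = Poly_Mapping.single (m + k - ?e) (of_nat (Poly_Mapping.lookup m i) * c * e)"
      using diff_single_add[of m i k] by (cases "Poly_Mapping.lookup m i = 0") auto
    have 2: "Poly_Mapping.single (m + (k - ?e)) (of_nat (Poly_Mapping.lookup k i) * e * c)
      = Poly_Mapping.single (m + k - ?e) (of_nat (Poly_Mapping.lookup k i) * e * c)"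
      using diff_single_add[of k i m] by (cases "Poly_Mapping.lookup k i = 0") (auto simp: add.commute)
    show ?case using 1 2
      by (simp add: pderivm_single mult_single lookup_add algebra_simps flip: single_add)
  qed (simp add: pderivm_add algebra_simps)
qed (simp add: pderivm_add algebra_simps)

lemma vars_in_pderivm: 
  assumes "f \<in> vars_in n" shows "pderivm i f \<in> vars_in n"
  unfolding pderivm_def
proof (intro vars_in_sum vars_in_single)
  fix m assume "m \<in> Poly_Mapping.keys f"
  moreover have "Poly_Mapping.keys (m - Poly_Mapping.single i 1) \<subseteq> Poly_Mapping.keys m"
    by (auto simp: in_keys_iff lookup_minus)
  ultimately show "Poly_Mapping.keys (m - Poly_Mapping.single i 1) \<subseteq> {..<n}"
    using assms by (auto simp: vars_in_def)
qed

lemma pderivm_X: "pderivm i (Xv s) = (if i = s then 1 else 0)"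
  by (auto simp: Xv_def pderivm_single lookup_single when_def)

lemma pderivm_X_power: "pderivm i (Xv s ^ Suc j) = (if i = s then of_nat (Suc j) * Xv s ^ j else 0)"
proof -
  have "Poly_Mapping.single i (Suc j) - Poly_Mapping.single i 1 = Poly_Mapping.single i j" 
    by (simp flip: single_diff)
  then show ?thesis
    unfolding X_power by (auto simp: pderivm_single lookup_single when_def of_nat_eq_Cst mult_single simp del: single_of_nat)
qed

lemma pderivm_hsym_other:
  assumes "finite A" "s \<notin> A" shows "pderivm s (hsym Xv A m) = 0"
  using assms
proof (induction A arbitrary: m rule: finite_induct)
  case empty show ?case by (cases m) auto
next
  case (insert t A)
  show ?case
  proof (induction m)
    case (Suc m)
    then show ?case using insert by (simp add: hsym_insert pderivm_add pderivm_mult pderivm_X)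
  qed simp
qed

text \<open>With s split off, differentiating h_{m+1}(A) = h_{m+1}(B) + x_s h_m(A) gives the
  recursion \<open>hsymd_Suc\<close>.\<close>

lemma pderivm_hsym:
  assumes "finite A" "s \<in> A" shows "pderivm s (hsym Xv A (Suc m)) = hsymd Xv A s m"
proof -
  define B where "B = A - {s}"
  have A: "A = insert s B" "finite B" "s \<notin> B" using assms by (auto simp: B_def)
  show ?thesis unfolding A(1)
  proof (induction m)
    case 0 then show ?case using A
      by (simp add: hsym_insert pderivm_add pderivm_mult pderivm_X pderivm_hsym_other)
  next
    case (Suc m) then show ?case using A
      by (subst hsym_insert) 
        (simp_all add: pderivm_add pderivm_mult pderivm_X pderivm_hsym_other hsymd_Suc)
  qed
qed


subsection \<open>Graded ideals\<close>

text \<open>Homogeneity is described by how a polynomial is generated, so that proofs can peel off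
  one variable at a time instead of inspecting coefficients.\<close>

inductive homog :: "nat set \<Rightarrow> nat \<Rightarrow> cpoly \<Rightarrow> bool" for C where
  "homog C 0 (Cst c)"
| "homog C m f \<Longrightarrow> s \<in> C \<Longrightarrow> homog C (Suc m) (Xv s * f)"
| "homog C m f \<Longrightarrow> homog C m g \<Longrightarrow> homog C m (f + g)"

text \<open>Pitfall: \<open>Hom {} m\<close> is empty for \<open>m > 0\<close>, so it does not contain 0.\<close>
definition Hom :: "nat set \<Rightarrow> nat \<Rightarrow> cpoly set" where
  "Hom C m = Collect (homog C m)"

lemma Hom_Cst: "Cst c \<in> Hom C 0"
  and Hom_X: "f \<in> Hom C m \<Longrightarrow> s \<in> C \<Longrightarrow> Xv s * f \<in> Hom C (Suc m)"
  and Hom_add: "f \<in> Hom C m \<Longrightarrow> g \<in> Hom C m \<Longrightarrow> f + g \<in> Hom C m"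
  by (simp_all add: Hom_def homog.intros)

lemma Hom_induct [consumes 1, case_names const var plus]:
  assumes "f \<in> Hom C m" "\<And>c. P 0 (Cst c)"
    "\<And>f m s. f \<in> Hom C m \<Longrightarrow> P m f \<Longrightarrow> s \<in> C \<Longrightarrow> P (Suc m) (Xv s * f)"
    "\<And>f m g. f \<in> Hom C m \<Longrightarrow> P m f \<Longrightarrow> g \<in> Hom C m \<Longrightarrow> P m g \<Longrightarrow> P m (f + g)"
  shows "P m f"
proof -
  have "homog C m f" using assms(1) by (simp add: Hom_def)
  then show ?thesis by (induction rule: homog.induct) (auto intro: assms(2-) simp: Hom_def)
qed

lemma Hom_0: "0 \<in> Hom C m" if "C \<noteq> {} \<or> m = 0"
proof (cases "C = {}")
  case True then show ?thesis using that Hom_Cst[of 0] by simp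
next
  case False
  then obtain s where "s \<in> C" by blast
  then show ?thesis
  proof (induction m)
    case 0 show ?case using Hom_Cst[of 0] by simp
  next
    case (Suc m) then show ?case using Hom_X[of 0 C m s] by simp
  qed
qed

lemma Hom_mono: "f \<in> Hom B m \<Longrightarrow> B \<subseteq> C \<Longrightarrow> f \<in> Hom C m"
  by (induction rule: Hom_induct) (auto intro: Hom_Cst Hom_X Hom_add)

lemma Hom_cmult: "f \<in> Hom C m \<Longrightarrow> Cst c * f \<in> Hom C m"
proof (induction rule: Hom_induct)
  case (var f m s)
  then show ?case using Hom_X[of "Cst c * f" C m s] by (simp add: mult_ac)
qed (auto simp: mult_single distrib_left intro: Hom_Cst Hom_X Hom_add)

lemma Hom_mult: "f \<in> Hom C m \<Longrightarrow> g \<in> Hom C k \<Longrightarrow> f * g \<in> Hom C (m + k)"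
proof (induction rule: Hom_induct)
  case (var f m s)
  then show ?case using Hom_X[of "f * g" C "m + k" s] by (simp add: mult_ac)
qed (auto simp: distrib_right intro: Hom_Cst Hom_X Hom_add Hom_cmult)

lemma Hom_1: "1 \<in> Hom C 0"
  using Hom_Cst[of 1] by simp

lemma Hom_Xv: "s \<in> C \<Longrightarrow> Xv s \<in> Hom C 1"
  using Hom_X[OF Hom_1] by simp

lemma Hom_Xv_power: "s \<in> C \<Longrightarrow> Xv s ^ j \<in> Hom C j"
  by (induction j) (auto intro: Hom_1 Hom_X)

lemma Hom_sum: "finite A \<Longrightarrow> A \<noteq> {} \<Longrightarrow> (\<And>a. a \<in> A \<Longrightarrow> f a \<in> Hom C m) \<Longrightarrow> sum f A \<in> Hom C m"
  by (induction A rule: finite_ne_induct) (auto intro: Hom_add)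

lemma Hom_empty: "f \<in> Hom {} m \<Longrightarrow> m = 0"
  by (induction rule: Hom_induct) auto

lemma Hom_hsym:
  assumes "finite A" "A \<noteq> {}" shows "hsym Xv A m \<in> Hom A m"
  using assms
proof (induction A arbitrary: m rule: finite_ne_induct)
  case (singleton t)
  show ?case by (induction m) (auto simp: hsym_insert Hom_1 intro: Hom_X)
next
  case (insert t A)
  show ?case
  proof (induction m)
    case (Suc m)
    have "hsym Xv A (Suc m) \<in> Hom (insert t A) (Suc m)"
      by (rule Hom_mono[OF insert.IH]) auto
    then show ?case using Suc insert by (simp add: hsym_insert Hom_add Hom_X)
  qed (simp add: Hom_1)
qed

text \<open>The pieces of such a homogeneous ideal need not consist of homogeneous polynomials; an ordinary ideal is
  the constant family.\<close>
definition gideal :: "nat set \<Rightarrow> (nat \<Rightarrow> cpoly set) \<Rightarrow> bool" where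
  "gideal C L \<longleftrightarrow> (\<forall>m. 0 \<in> L m) \<and> (\<forall>m. \<forall>f\<in>L m. \<forall>g\<in>L m. f + g \<in> L m) \<and>
     (\<forall>m k. \<forall>f\<in>L m. \<forall>c\<in>Hom C k. c * f \<in> L (k + m))"

lemma gidealI:
  assumes "\<And>m. 0 \<in> L m" "\<And>m f g. f \<in> L m \<Longrightarrow> g \<in> L m \<Longrightarrow> f + g \<in> L m"
    "\<And>m k f c. f \<in> L m \<Longrightarrow> c \<in> Hom C k \<Longrightarrow> c * f \<in> L (k + m)"
  shows "gideal C L"
  using assms unfolding gideal_def by blast

context
  fixes C L assumes L: "gideal C L"
begin

lemma gideal_0: "0 \<in> L m"
  using L unfolding gideal_def by blast

lemma gideal_add: "f \<in> L m \<Longrightarrow> g \<in> L m \<Longrightarrow> f + g \<in> L m"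
  using L unfolding gideal_def by blast

lemma gideal_mult: "f \<in> L m \<Longrightarrow> c \<in> Hom C k \<Longrightarrow> c * f \<in> L (k + m)"
  using L unfolding gideal_def by blast

lemma gideal_cmult: "f \<in> L m \<Longrightarrow> Cst c * f \<in> L m"
  using gideal_mult[of f m "Cst c" 0] by (simp add: Hom_Cst)

lemma gideal_X: "f \<in> L m \<Longrightarrow> s \<in> C \<Longrightarrow> Xv s * f \<in> L (Suc m)"
  using gideal_mult[of f m "Xv s" 1] Hom_Xv[of s C] by simp

lemma gideal_diff: 
  assumes "f \<in> L m" "g \<in> L m" shows "f - g \<in> L m"
proof -
  have "f + Cst (-1) * g \<in> L m" using assms by (intro gideal_add gideal_cmult)
  then show ?thesis by (simp add: single_uminus)
qed

lemma gideal_sum: "(\<And>a. a \<in> A \<Longrightarrow> f a \<in> L m) \<Longrightarrow> sum f A \<in> L m"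
  by (induction A rule: infinite_finite_induct) (auto intro: gideal_add gideal_0)

lemma gideal_subset: "B \<subseteq> C \<Longrightarrow> gideal B L"
  by (rule gidealI) (auto intro: gideal_0 gideal_add gideal_mult Hom_mono)

lemma gideal_of_nat_cancel:
  assumes "of_nat k * f \<in> L m" "k > 0" shows "f \<in> L m"
proof -
  have "Cst (inverse (of_nat k)) * (of_nat k * f) \<in> L m" by (rule gideal_cmult[OF assms(1)])
  then show ?thesis using assms(2) unfolding of_nat_eq_Cst by (subst (asm) Cst_inverse_cancel) auto
qed

text \<open>Modulo L the variables in U vanish, so only polynomials in the variables of B remain to
  be considered.\<close>

lemma Hom_mod_variables:
  assumes "C = U \<union> B" "\<And>s. s \<in> U \<Longrightarrow> Xv s \<in> L 1" "Hom B m \<subseteq> L m" "f \<in> Hom C m"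
  shows "f \<in> L m"
proof -
  \<comment> \<open>The first alternative is separate because for empty B and m > 0 there is no
    representative in \<open>Hom B m\<close>, not even 0.\<close>
  have "f \<in> Hom C m \<Longrightarrow> f \<in> L m \<or> (\<exists>g\<in>Hom B m. f - g \<in> L m)" for f m
  proof (induction rule: Hom_induct)
    case (const c)
    then show ?case using Hom_Cst[of c B] gideal_0 by (metis diff_self)
  next
    case (var f m s)
    show ?case
    proof (cases "s \<in> U")
      case True
      then have "f * Xv s \<in> L (m + 1)" using var gideal_mult assms(2) by blast
      then show ?thesis by (simp add: mult.commute)
    next
      case False
      then have s: "s \<in> B" using var assms(1) by blast
      from var.IH show ?thesis
      proof
        assume "f \<in> L m" then show ?thesis using gideal_X var by blast
      next
        assume "\<exists>g\<in>Hom B m. f - g \<in> L m"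
        then obtain g where g: "g \<in> Hom B m" "f - g \<in> L m" by blast
        then have "Xv s * (f - g) \<in> L (Suc m)" using gideal_X var by blast
        then have "Xv s * f - Xv s * g \<in> L (Suc m)" by (simp add: right_diff_distrib)
        then show ?thesis using Hom_X[OF g(1) s] by blast
      qed
    qed
  next
    case (plus f m g)
    have "\<exists>f'\<in>Hom B m. f + g - f' \<in> L m"
      if f': "f' \<in> Hom B m" "f - f' \<in> L m" and "g \<in> L m" for f f' g
    proof -
      have "f + g - f' = (f - f') + g" by simp
      then show ?thesis using that gideal_add by metis
    qed
    moreover have "\<exists>f'\<in>Hom B m. f + g - f' \<in> L m"
      if "f' \<in> Hom B m" "f - f' \<in> L m" "g' \<in> Hom B m" "g - g' \<in> L m" for f f' g g'
    proof -
      have "f + g - (f' + g') = (f - f') + (g - g')" by simp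
      then show ?thesis using that gideal_add Hom_add by metis
    qed
    ultimately show ?case using plus.IH gideal_add by (metis add.commute)
  qed
  from this[OF assms(4)] show ?thesis
  proof
    assume "\<exists>g\<in>Hom B m. f - g \<in> L m"
    then obtain g where "g \<in> L m" "f - g \<in> L m" using assms(3) by blast
    then have "f - g + g \<in> L m" by (intro gideal_add)
    then show ?thesis by simp
  qed
qed

text \<open>This is the colon ideal of L by x_s, with degrees shifted by one.\<close>

lemma gideal_colon: "s \<in> C \<Longrightarrow> gideal C (\<lambda>m. {u. Xv s * u \<in> L (Suc m)})"
proof (rule gidealI)
  fix m k f c assume "f \<in> {u. Xv s * u \<in> L (Suc m)}" "c \<in> Hom C k"
  then have "c * (Xv s * f) \<in> L (k + Suc m)" by (intro gideal_mult) auto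
  then show "c * f \<in> {u. Xv s * u \<in> L (Suc (k + m))}" by (simp add: mult_ac)
qed (auto simp: distrib_left intro: gideal_0 gideal_add)

text \<open>This is the ideal generated by L and x_s; the alternative v = 0 covers degree 0, where
  there are no multiples of x_s.\<close>

lemma gideal_sum_variable:
  assumes "s \<in> C"
  shows "gideal C (\<lambda>m. {l + v | l v. l \<in> L m \<and> (v = 0 \<or> (\<exists>u m'. m = Suc m' \<and> u \<in> Hom C m' \<and> v = Xv s * u))})"
    (is "gideal C (\<lambda>m. {l + v | l v. l \<in> L m \<and> ?V v m})")
proof (rule gidealI)
  fix m show "0 \<in> {l + v | l v. l \<in> L m \<and> ?V v m}" using gideal_0[of m] by force
next
  fix m f g assume "f \<in> {l + v | l v. l \<in> L m \<and> ?V v m}" "g \<in> {l + v | l v. l \<in> L m \<and> ?V v m}"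
  then obtain l v l' v' where f: "f = l + v" "l \<in> L m" "?V v m" and g: "g = l' + v'" "l' \<in> L m" "?V v' m"
    by blast
  have "?V (v + v') m"
  proof (cases "v = 0 \<or> v' = 0")
    case True then show ?thesis using f(3) g(3) by auto
  next
    case False
    then obtain u u' m' where "m = Suc m'" "u \<in> Hom C m'" "u' \<in> Hom C m'" "v = Xv s * u" "v' = Xv s * u'"
      using f(3) g(3) by blast
    then show ?thesis using Hom_add[of u C m' u'] by (auto simp: distrib_left)
  qed
  then have "(l + l') + (v + v') \<in> {l + v | l v. l \<in> L m \<and> ?V v m}" 
    using gideal_add[OF f(2) g(2)] by blast
  moreover have "f + g = (l + l') + (v + v')" using f g by simp
  ultimately show "f + g \<in> {l + v | l v. l \<in> L m \<and> ?V v m}" by metis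
next
  fix m k f c assume "f \<in> {l + v | l v. l \<in> L m \<and> ?V v m}" and c: "c \<in> Hom C k"
  then obtain l v where f: "f = l + v" "l \<in> L m" "?V v m" by blast
  have "?V (c * v) (k + m)"
  proof (cases "v = 0")
    case False
    then obtain u m' where u: "m = Suc m'" "u \<in> Hom C m'" "v = Xv s * u" using f by blast
    then have "c * u \<in> Hom C (k + m')" "c * v = Xv s * (c * u)" using c by (auto intro: Hom_mult)
    then show ?thesis using u(1) by auto
  qed auto
  moreover have "c * l \<in> L (k + m)" using f c gideal_mult by blast
  ultimately show "c * f \<in> {l + v | l v. l \<in> L (k + m) \<and> ?V v (k + m)}"
    unfolding f(1) distrib_left by blast
qed

text \<open>By \<open>hsymd_insert\<close>, dropping a variable x_t changes the polynomial by a
  multiple of x_t, which lies in L.\<close>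

lemma hsymd_mod_variables:
  assumes "finite B" "\<And>t. t \<in> U \<Longrightarrow> Xv t \<in> L 1" "finite U" "U \<inter> B = {}" "U \<union> B \<subseteq> C" "s \<in> B"
    "hsymd Xv (U \<union> B) s e \<in> L e"
  shows "hsymd Xv B s e \<in> L e"
  using assms(3,2,4,5,7)
proof (induction U rule: finite_induct)
  case (insert t U)
  have "hsymd Xv (U \<union> B) s e \<in> L e"
  proof (cases e)
    case 0 then show ?thesis using insert by simp
  next
    case (Suc e')
    have "hsymd Xv (insert t (U \<union> B)) s e' \<in> Hom C e'" 
      unfolding hsymd_eq_sum using insert.prems assms(6)
    proof (intro Hom_sum)
      fix a assume "a \<in> {..e'}"
      then have "Xv s ^ a * hsym Xv (insert t (U \<union> B)) (e' - a) \<in> Hom C (a + (e' - a))"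
        using insert.hyps insert.prems assms(1,5,6)
        by (intro Hom_mult Hom_Xv_power Hom_mono[OF Hom_hsym]) auto
      then show "Xv s ^ a * hsym Xv (insert t (U \<union> B)) (e' - a) \<in> Hom C e'"
        using \<open>a \<in> {..e'}\<close> by simp
    qed auto
    then have "hsymd Xv (insert t (U \<union> B)) s e' * Xv t \<in> L (e' + 1)"
      using insert.prems(1) by (intro gideal_mult) auto
    then have "hsymd Xv (insert t (U \<union> B)) s e - Xv t * hsymd Xv (insert t (U \<union> B)) s e' \<in> L e"
      using insert.prems Suc by (intro gideal_diff) (auto simp: mult.commute)
    then show ?thesis using insert assms(1) by (simp add: hsymd_insert Suc)
  qed
  then show ?case using insert by auto
qed simp

end

text \<open>The partial derivatives of \<^term>\<open>hsym Xv B (Suc d)\<close> form a regular sequence of degree \<open>d\<close>, so the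
  quotient vanishes above degree \<open>|B| (d - 1)\<close>. By Euler's identity the ideal contains the products
  \<open>x\<^sub>s \<partial>\<^sub>s h\<^sub>d\<close>; splitting them one factor at a time reduces to subsets of \<open>B\<close> and degree \<open>d - 1\<close>.\<close>
lemma Hom_subset_hsymd:
  assumes "finite B" "gideal B L" "\<And>s. s \<in> B \<Longrightarrow> hsymd Xv B s d \<in> L d"
    "int m > int (card B) * (int d - 1)"
  shows "Hom B m \<subseteq> L m"
  using assms
proof (induction d arbitrary: B L m)
  case 0
  \<comment> \<open>In degree 0 the polynomial \<open>hsymd\<close> is 1, so L contains everything
    homogeneous. Without variables the bound forces m > 0, and \<open>Hom {} m\<close> is
    empty.\<close>
  show ?case
  proof (cases "B = {}")
    case True
    then show ?thesis using 0 Hom_empty[of _ m] by fastforce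
  next
    case False
    then have "1 \<in> L 0" using 0 by auto
    then show ?thesis using gideal_mult[OF 0(2), of 1 0] by auto
  qed
next
  case (Suc e)
  \<comment> \<open>The variables in U lie in L, those in B' have their derivative in L, and for
    those in R only the product of variable and derivative is known to lie in L. Elements of R are
    resolved one at a time; when none is left, L is treated modulo U by the hypothesis for
    e.\<close>
  have split: "Hom C m \<subseteq> L m"
    if "finite R" "finite U" "finite B'" "gideal C L" "C = U \<union> B' \<union> R" "U \<inter> B' = {}" "U \<inter> R = {}" "B' \<inter> R = {}"
      "\<And>s. s \<in> U \<Longrightarrow> Xv s \<in> L 1" "\<And>s. s \<in> B' \<Longrightarrow> hsymd Xv C s e \<in> L e"
      "\<And>s. s \<in> R \<Longrightarrow> Xv s * hsymd Xv C s e \<in> L (Suc e)"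
      "int m > int (card B') * (int e - 1) + int (card R) * int e"
    for R U B' C L m
    using that
  proof (induction R arbitrary: U B' L m rule: finite_induct)
    case empty
    have "Hom B' m \<subseteq> L m"
    proof (rule Suc.IH)
      show "gideal B' L" using gideal_subset[OF empty(3), of B'] empty(4) by auto
      show "hsymd Xv B' s e \<in> L e" if "s \<in> B'" for s
        using that empty by (intro hsymd_mod_variables[OF empty(3), of B' U]) auto
    qed (use empty in auto)
    then show ?case using Hom_mod_variables[OF empty(3), of U B' m] empty by auto
  next
    case (insert r R)
    note L = insert.prems(3)
    have r: "r \<in> C" using insert by auto
    \<comment> \<open>The colon ideal by x_r contains the derivative at r, so r moves to B'; the
      ideal enlarged by x_r lets r move to U. In the first case the bound drops by one, exactly as
      the degree does; in the second it drops by e.\<close>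
    let ?L1 = "\<lambda>m. {u. Xv r * u \<in> L (Suc m)}"
    let ?L2 = "\<lambda>m. {l + v | l v. l \<in> L m \<and> (v = 0 \<or> (\<exists>u m'. m = Suc m' \<and> u \<in> Hom C m' \<and> v = Xv r * u))}"
    have L2: "L m \<subseteq> ?L2 m" for m by force
    have cr: "int (card (insert r R)) * int e = int (card R) * int e + int e" 
      using insert.hyps by (simp add: algebra_simps)
    have cb: "int (card (insert r B')) * (int e - 1) = int (card B') * (int e - 1) + (int e - 1)"
      using insert.prems(7) insert.prems(2) by (subst card_insert_disjoint) (auto simp: algebra_simps)
    have L1': "Hom C m' \<subseteq> ?L1 m'" if "m = Suc m'" for m'
    proof (rule insert.IH[of U "insert r B'"])
      show "gideal C ?L1" by (rule gideal_colon[OF L r])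
      show "Xv s \<in> ?L1 1" if "s \<in> U" for s
        using gideal_X[OF L insert.prems(8)[OF that] r] by simp
      show "hsymd Xv C s e \<in> ?L1 e" if "s \<in> insert r B'" for s
        using that insert.prems(9)[of s] insert.prems(10)[of r] gideal_X[OF L _ r] by auto
      show "Xv s * hsymd Xv C s e \<in> ?L1 (Suc e)" if "s \<in> R" for s
        using that insert.prems(10)[of s] gideal_X[OF L _ r] by auto
      show "int (card (insert r B')) * (int e - 1) + int (card R) * int e < int m'"
        using insert.prems(11) that unfolding cr cb by linarith
    qed (use insert.prems(1-7) insert.hyps in blast)+
    have L2': "Hom C m \<subseteq> ?L2 m"
    proof (rule insert.IH[of "insert r U" B'])
      show "gideal C ?L2" by (rule gideal_sum_variable[OF L r])
      show "Xv s \<in> ?L2 1" if "s \<in> insert r U" for s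
      proof (cases "s = r")
        case True
        have "Xv r = 0 + Xv r * 1" by simp
        then show ?thesis using Hom_1[of C] gideal_0[OF L, of 1] True by fastforce
      next
        case False then show ?thesis using that insert.prems(8)[of s] L2 by blast
      qed
      show "hsymd Xv C s e \<in> ?L2 e" if "s \<in> B'" for s
        using insert.prems(9)[OF that] L2 by blast
      show "Xv s * hsymd Xv C s e \<in> ?L2 (Suc e)" if "s \<in> R" for s
        using insert.prems(10)[of s] that L2 by blast
      show "int (card B') * (int e - 1) + int (card R) * int e < int m"
        using insert.prems(11) unfolding cr by linarith
    qed (use insert.prems(1-7) insert.hyps in blast)+
    show ?case
    proof
      fix f assume "f \<in> Hom C m"
      then obtain l v where f: "f = l + v" "l \<in> L m" "v = 0 \<or> (\<exists>u m'. m = Suc m' \<and> u \<in> Hom C m' \<and> v = Xv r * u)"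
        using L2' by blast
      have "v \<in> L m" using f(3) L1' gideal_0[OF L] by blast
      then show "f \<in> L m" using f gideal_add[OF L] by blast
    qed
  qed
  note L = Suc.prems(2)
  \<comment> \<open>Summing the hypotheses, Euler's identity leaves (|B| + e + 1) h_{e+1}.
    Subtracting h_{e+1} from \<open>hsymd Xv B s (Suc e)\<close> then leaves the product that
    \<open>split\<close> asks for.\<close>
  have h: "hsym Xv B (Suc e) \<in> L (Suc e)" if "B \<noteq> {}"
  proof (rule gideal_of_nat_cancel[OF L, of "card B + Suc e"])
    have "(\<Sum>s\<in>B. hsymd Xv B s (Suc e)) = of_nat (card B + Suc e) * hsym Xv B (Suc e)"
      using hsym_euler[OF Suc.prems(1), of Xv e] by (simp add: hsymd_Suc sum.distrib distrib_right del: single_of_nat)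
    moreover have "(\<Sum>s\<in>B. hsymd Xv B s (Suc e)) \<in> L (Suc e)"
      by (rule gideal_sum[OF L]) (rule Suc.prems(3))
    ultimately show "of_nat (card B + Suc e) * hsym Xv B (Suc e) \<in> L (Suc e)" by simp
  qed simp
  show ?case
  proof (rule split[of B "{}" "{}" B L m])
    show "Xv s * hsymd Xv B s e \<in> L (Suc e)" if "s \<in> B" for s
      using gideal_diff[OF L Suc.prems(3)[OF that] h] that by (auto simp: hsymd_Suc)
  qed (use Suc.prems in auto)
qed

text \<open>One step of Artin's reduction: the complete symmetric polynomial is monic in the new variable.\<close>
lemma Hom_insert_subset:
  assumes "finite A" "t \<notin> A" "gideal (insert t A) L" "hsym Xv (insert t A) (Suc e) \<in> L (Suc e)"
    "\<And>m. int m > N \<Longrightarrow> Hom A m \<subseteq> L m" "int m > N + int e" 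
  shows "Hom (insert t A) m \<subseteq> L m"
proof -
  note L = assms(3)
  \<comment> \<open>Strong induction on the power of x_t. Up to x_t^e the cofactor f already has
    degree above N; beyond that, a multiple of h_{e+1} trades x_t^{e+1} for lower powers in the same
    total degree.\<close>
  have A: "Xv t ^ i * f \<in> L (i + j)" if "f \<in> Hom A j" "int (i + j) > N + int e" for i j f
    using that
  proof (induction i arbitrary: j f rule: less_induct)
    case (less i)
    show ?case
    proof (cases "i \<le> e")
      case True
      then have "f \<in> L j" using less.prems assms(5)[of j] by auto
      then show ?thesis by (intro gideal_mult[OF L]) (auto intro: Hom_Xv_power)
    next
      case False
      define k where "k = i - Suc e"
      have i: "i = k + Suc e" using False by (simp add: k_def)
      have f: "f \<in> Hom (insert t A) j" by (rule Hom_mono[OF less.prems(1)]) auto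
      have "(Xv t ^ k * f) * hsym Xv (insert t A) (Suc e) \<in> L ((k + j) + Suc e)"
        by (intro gideal_mult[OF L assms(4)] Hom_mult Hom_Xv_power f) auto
      moreover have "(\<Sum>a\<le>e. Xv t ^ (k + a) * (hsym Xv A (Suc e - a) * f)) \<in> L (k + j + Suc e)"
      proof (rule gideal_sum[OF L])
        fix a assume "a \<in> {..e}"
        then have a: "a \<le> e" by simp
        show "Xv t ^ (k + a) * (hsym Xv A (Suc e - a) * f) \<in> L (k + j + Suc e)"
        \<comment> \<open>For empty A the factor h of positive degree is 0, which
          \<open>Hom {} m\<close> with m > 0 does not contain.\<close>
        proof (cases "A = {}")
          case True
          then have "hsym Xv A (Suc e - a) = 0" using a by (simp add: Suc_diff_le)
          then show ?thesis using gideal_0[OF L] by simp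
        next
          case False
          have "Xv t ^ (k + a) * (hsym Xv A (Suc e - a) * f) \<in> L ((k + a) + ((Suc e - a) + j))"
            using a less.prems i False assms(1) by (intro less.IH Hom_mult Hom_hsym) auto
          then show ?thesis using a by (simp add: add_ac)
        qed
      qed
      ultimately have "(Xv t ^ k * f) * hsym Xv (insert t A) (Suc e)
          - (\<Sum>a\<le>e. Xv t ^ (k + a) * (hsym Xv A (Suc e - a) * f)) \<in> L (k + j + Suc e)"
        by (rule gideal_diff[OF L])
      moreover have "(Xv t ^ k * f) * hsym Xv (insert t A) (Suc e)
          - (\<Sum>a\<le>e. Xv t ^ (k + a) * (hsym Xv A (Suc e - a) * f)) = Xv t ^ i * f"
        using assms(1,2)
        by (simp add: hsym_insert_expand distrib_left sum_distrib_left i power_add mult_ac)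
      ultimately show ?thesis by (simp add: i add_ac)
    qed
  qed
  \<comment> \<open>While f is taken apart, i collects its factors x_t and g its other
    variables.\<close>
  have "Xv t ^ i * (g * f) \<in> L (i + (j + m))"
    if "f \<in> Hom (insert t A) m" "g \<in> Hom A j" "int (i + (j + m)) > N + int e" for f g i j m
    using that
  proof (induction arbitrary: i j g rule: Hom_induct)
    case (const c)
    then show ?case using A[of "Cst c * g" j i] Hom_cmult[of g A j c] by (simp add: mult.commute)
  next
    case (var f m s)
    show ?case
    proof (cases "s = t")
      case True
      then show ?thesis using var.IH[of g j "Suc i"] var.prems by (simp add: mult_ac)
    next
      case False
      then have "Xv s * g \<in> Hom A (Suc j)" using var by (auto intro: Hom_X)
      from var.IH[OF this, of i] show ?thesis using var.prems by (simp add: mult_ac)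
    qed
  next
    case (plus f m f')
    then show ?case by (simp add: distrib_left gideal_add[OF L])
  qed
  from this[OF _ Hom_1[of A], of _ m 0] show ?thesis using assms(6) by auto
qed


subsection \<open>Forms as families of polynomials\<close>

text \<open>A family of polynomials indexed by the sets \<open>V\<close> stands for the form \<open>\<Sum>\<^sub>V F\<^sub>V dx\<^sub>V\<close>.\<close>
definition to_form :: "(nat set \<Rightarrow> cpoly) \<Rightarrow> form" where
  "to_form F = (\<lambda>(m, V). Poly_Mapping.lookup (F V) m)"

definition coeff_family :: "form \<Rightarrow> nat set \<Rightarrow> cpoly" where
  "coeff_family \<omega> V = Abs_poly_mapping (\<lambda>m. \<omega> (m, V))"

definition Families :: "nat \<Rightarrow> (nat set \<Rightarrow> cpoly) set" where
  "Families n = {F. (\<forall>V. F V \<in> vars_in n) \<and> (\<forall>V. \<not> V \<subseteq> {..<n} \<longrightarrow> F V = 0)}"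

definition fwedge :: "(nat set \<Rightarrow> cpoly) \<Rightarrow> (nat set \<Rightarrow> cpoly) \<Rightarrow> nat set \<Rightarrow> cpoly" where
  "fwedge F G V = (\<Sum>S\<in>Pow V. Cst (wsign S (V - S)) * (F S * G (V - S)))"

definition unitf :: "nat set \<Rightarrow> cpoly \<Rightarrow> nat set \<Rightarrow> cpoly" where
  "unitf T f V = (if V = T then f else 0)"

definition oneform :: "nat \<Rightarrow> (nat \<Rightarrow> cpoly) \<Rightarrow> nat set \<Rightarrow> cpoly" where
  "oneform n g V = (\<Sum>i<n. unitf {i} (g i) V)"

text \<open>Left wedge product with \<open>oneform n g\<close> in closed form, see
  \<open>fwedge_oneform\<close>; it avoids sums over subsets.\<close>

definition dwedge :: "nat \<Rightarrow> (nat \<Rightarrow> cpoly) \<Rightarrow> (nat set \<Rightarrow> cpoly) \<Rightarrow> nat set \<Rightarrow> cpoly" where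
  "dwedge n g G V = (\<Sum>i\<in>V \<inter> {..<n}. Cst (wsign {i} (V - {i})) * (g i * G (V - {i})))"

definition powsum :: "nat \<Rightarrow> nat \<Rightarrow> cpoly" where
  "powsum n j = (\<Sum>i<n. Xv i ^ j)"

definition dpow :: "nat \<Rightarrow> nat \<Rightarrow> cpoly" where
  "dpow j i = of_nat j * Xv i ^ (j - 1)"

lemma to_form_inject: "to_form F = to_form G \<longleftrightarrow> F = G"
proof
  assume *: "to_form F = to_form G"
  show "F = G"
  proof (intro ext poly_mapping_eqI)
    fix V m
    have "to_form F (m, V) = to_form G (m, V)" using * by simp
    then show "Poly_Mapping.lookup (F V) m = Poly_Mapping.lookup (G V) m" by (simp add: to_form_def)
  qed
qed simp

section \<open>Wedge products in terms of polynomial products\<close>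

text \<open>Both summands are bounded by m pointwise. Finiteness matters because sums over infinite
  sets default to 0.\<close>

lemma finite_add_decomp: "finite {(a, b). a + b = (m :: nat \<Rightarrow>\<^sub>0 nat)}"
proof -
  let ?K = "Poly_Mapping.keys m"
  let ?F = "{f. \<forall>i. (i \<in> ?K \<longrightarrow> f i \<in> {..Max (Poly_Mapping.lookup m ` ?K)}) \<and> (i \<notin> ?K \<longrightarrow> f i = (0::nat))}"
  have fin: "finite ?F" by (rule finite_set_of_finite_funs) auto
  have mem: "Poly_Mapping.lookup a \<in> ?F" if "a + b = m" for a b
  proof -
    have le: "Poly_Mapping.lookup a i \<le> Poly_Mapping.lookup m i" for i
      unfolding that[symmetric] by (simp add: lookup_add)
    have "Poly_Mapping.lookup a i \<le> Max (Poly_Mapping.lookup m ` ?K)" if "i \<in> ?K" for i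
      by (rule order_trans[OF le Max_ge]) (use that in auto)
    moreover have "Poly_Mapping.lookup a i = 0" if "i \<notin> ?K" for i
      using le[of i] that by (simp add: in_keys_iff)
    ultimately show ?thesis by blast
  qed
  let ?g = "\<lambda>p :: (nat \<Rightarrow>\<^sub>0 nat) \<times> (nat \<Rightarrow>\<^sub>0 nat). (Poly_Mapping.lookup (fst p), Poly_Mapping.lookup (snd p))"
  have "inj_on ?g {(a, b). a + b = m}"
    by (intro inj_onI prod_eqI) (auto simp: lookup_inject)
  moreover have "?g ` {(a, b). a + b = m} \<subseteq> ?F \<times> ?F"
  proof (rule image_subsetI)
    fix p assume "p \<in> {(a, b). a + b = m}"
    then have "fst p + snd p = m" by (simp add: case_prod_unfold)
    then have "Poly_Mapping.lookup (fst p) \<in> ?F" "Poly_Mapping.lookup (snd p) \<in> ?F"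
      using mem[of "fst p" "snd p"] mem[of "snd p" "fst p"] by (auto simp only: add.commute)
    then show "?g p \<in> ?F \<times> ?F" by (rule SigmaI)
  qed
  ultimately show ?thesis using fin by (meson finite_SigmaI finite_imageD finite_subset)
qed

lemma lookup_mult_sum:
  fixes f g :: cpoly
  shows "Poly_Mapping.lookup (f * g) m
    = (\<Sum>(a, b)\<in>{(a, b). a + b = m}. Poly_Mapping.lookup f a * Poly_Mapping.lookup g b)"
proof (induction f rule: cpoly_induct)
  case (single k c)
  show ?case
  proof (induction g rule: cpoly_induct)
    case (single l e)
    have "(\<Sum>(a, b)\<in>{(a, b). a + b = m}. Poly_Mapping.lookup (Poly_Mapping.single k c) a * Poly_Mapping.lookup (Poly_Mapping.single l e) b)
       = (\<Sum>p\<in>{(a, b). a + b = m}. if p = (k, l) then c * e else 0)"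
      by (intro sum.cong) (auto simp: lookup_single when_def split: if_splits)
    then show ?case by (auto simp: mult_single lookup_single when_def sum.delta finite_add_decomp)
  qed (simp add: distrib_left lookup_add case_prod_unfold sum.distrib)
qed (simp add: distrib_right lookup_add case_prod_unfold sum.distrib)

lemma lookup_Cst_mult: "Poly_Mapping.lookup (Cst c * f) m = c * Poly_Mapping.lookup f m" for f :: cpoly
  by (induction f rule: cpoly_induct) (auto simp: mult_single lookup_single when_def distrib_left lookup_add)

text \<open>A splitting of V is determined by its first block S; for fixed S, the sum over exponents
  is a coefficient of a product of polynomials.\<close>

lemma wedge_to_form:
  assumes F: "\<And>V. infinite V \<Longrightarrow> F V = 0" and G: "\<And>V. infinite V \<Longrightarrow> G V = 0"
  shows "wedge (to_form F) (to_form G) = to_form (fwedge F G)"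
proof (rule ext, clarify)
  fix m :: "nat \<Rightarrow>\<^sub>0 nat" and V :: "nat set"
  let ?D = "{((m1, S1), (m2, S2)). m1 + m2 = m \<and> S1 \<union> S2 = V \<and> S1 \<inter> S2 = {}}"
  let ?f = "\<lambda>P. case P of ((m1, S1), (m2, S2)) \<Rightarrow> wsign S1 S2 * to_form F (m1, S1) * to_form G (m2, S2)"
  let ?A = "{(a, b). a + b = m}"
  show "wedge (to_form F) (to_form G) (m, V) = to_form (fwedge F G) (m, V)"
  proof (cases "finite V")
    case False
    \<comment> \<open>If V is infinite then so is one of the blocks, while \<open>fwedge\<close>
      sums over the infinite set \<open>Pow V\<close>; both sides are 0.\<close>
    have "wedge (to_form F) (to_form G) (m, V) = 0"
      unfolding wedge_def prod.case
    proof (rule sum.neutral, clarify)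
      fix m1 S1 m2 S2 assume "V = S1 \<union> S2" "S1 \<inter> S2 = {}" 
      then show "wsign S1 S2 * to_form F (m1, S1) * to_form G (m2, S2) = 0"
        using False F[of S1] G[of S2] by (auto simp: to_form_def)
    qed
    then show ?thesis using False by (simp add: to_form_def fwedge_def)
  next
    case True
    have inj: "inj_on (\<lambda>(S, a, b). ((a, S), (b, V - S))) (Pow V \<times> ?A)"
      by (auto simp: inj_on_def)
    have im: "?D = (\<lambda>(S, a, b). ((a, S), (b, V - S))) ` (Pow V \<times> ?A)"
    proof (intro equalityI subsetI)
      fix P assume "P \<in> ?D"
      then obtain m1 S1 m2 S2 where P: "P = ((m1, S1), (m2, S2))" "m1 + m2 = m" "S1 \<union> S2 = V" "S1 \<inter> S2 = {}"
        by auto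
      then have "S2 = V - S1" by auto
      then have "P = (\<lambda>(S, a, b). ((a, S), (b, V - S))) (S1, m1, m2)" using P by simp
      then show "P \<in> (\<lambda>(S, a, b). ((a, S), (b, V - S))) ` (Pow V \<times> ?A)" using P by blast
    qed auto
    have "wedge (to_form F) (to_form G) (m, V) = sum ?f ?D" by (simp add: wedge_def)
    also have "\<dots> = (\<Sum>(S, a, b)\<in>Pow V \<times> ?A. wsign S (V - S) * Poly_Mapping.lookup (F S) a * Poly_Mapping.lookup (G (V - S)) b)"
      unfolding im by (subst sum.reindex[OF inj]) (simp add: case_prod_unfold to_form_def)
    also have "\<dots> = (\<Sum>S\<in>Pow V. \<Sum>(a, b)\<in>?A. wsign S (V - S) * Poly_Mapping.lookup (F S) a * Poly_Mapping.lookup (G (V - S)) b)"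
      by (subst sum.cartesian_product[symmetric]) (simp add: case_prod_unfold)
    also have "\<dots> = (\<Sum>S\<in>Pow V. wsign S (V - S) * Poly_Mapping.lookup (F S * G (V - S)) m)"
      by (simp add: lookup_mult_sum sum_distrib_left case_prod_unfold mult.assoc)
    also have "\<dots> = to_form (fwedge F G) (m, V)"
      by (simp add: to_form_def fwedge_def lookup_sum lookup_Cst_mult)
    finally show ?thesis .
  qed
qed

lemma wsign_empty [simp]: "wsign {} S = 1" "wsign S {} = 1"
  by (simp_all add: wsign_def)

lemma wsign_square: "wsign S T * wsign S T = 1"
  by (simp add: wsign_def power_add[symmetric] mult_2[symmetric])

lemma Families_infinite: "F \<in> Families n \<Longrightarrow> infinite V \<Longrightarrow> F V = 0"
  unfolding Families_def using finite_subset by blast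

lemma to_form_coeff_family:
  assumes "\<omega> \<in> Omega n"
  shows "to_form (coeff_family \<omega>) = \<omega>" "coeff_family \<omega> \<in> Families n"
proof -
  have om: "finite {b. \<omega> b \<noteq> 0}" "\<omega> (m, V) \<noteq> 0 \<Longrightarrow> Poly_Mapping.keys m \<subseteq> {..<n} \<and> V \<subseteq> {..<n}" for m V
    using assms unfolding Omega_def by blast+
  have fin: "finite {m. \<omega> (m, V) \<noteq> 0}" for V
  proof (rule finite_imageD)
    have "(\<lambda>m. (m, V)) ` {m. \<omega> (m, V) \<noteq> 0} \<subseteq> {b. \<omega> b \<noteq> 0}" by blast
    then show "finite ((\<lambda>m. (m, V)) ` {m. \<omega> (m, V) \<noteq> 0})"
      using om(1) by (rule finite_subset)
  qed (simp add: inj_on_def)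
  have l: "Poly_Mapping.lookup (coeff_family \<omega> V) m = \<omega> (m, V)" for m V
    unfolding coeff_family_def using fin by simp
  show "to_form (coeff_family \<omega>) = \<omega>" by (auto simp: to_form_def l)
  have "coeff_family \<omega> V = 0" if "\<not> V \<subseteq> {..<n}" for V
  proof (rule poly_mapping_eqI)
    fix m show "Poly_Mapping.lookup (coeff_family \<omega> V) m = Poly_Mapping.lookup 0 m"
      using om(2)[of m V] that by (auto simp only: l lookup_zero)
  qed
  moreover have "coeff_family \<omega> V \<in> vars_in n" for V
    unfolding vars_in_def
  proof (intro CollectI ballI)
    fix m assume "m \<in> Poly_Mapping.keys (coeff_family \<omega> V)"
    then have "\<omega> (m, V) \<noteq> 0" by (simp add: in_keys_iff l)
    then show "Poly_Mapping.keys m \<subseteq> {..<n}" using om(2) by blast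
  qed
  ultimately show "coeff_family \<omega> \<in> Families n" by (simp add: Families_def)
qed

lemma to_form_Omega:
  assumes "F \<in> Families n" shows "to_form F \<in> Omega n"
proof -
  have "{b. to_form F b \<noteq> 0} \<subseteq> (\<Union>V\<in>Pow {..<n}. (\<lambda>m. (m, V)) ` Poly_Mapping.keys (F V))"
  proof
    fix b assume "b \<in> {b. to_form F b \<noteq> 0}"
    moreover obtain m V where "b = (m, V)" by (cases b)
    ultimately have b: "b = (m, V)" "Poly_Mapping.lookup (F V) m \<noteq> 0" by (auto simp: to_form_def)
    then have "V \<subseteq> {..<n}" using assms by (auto simp: Families_def)
    moreover have "m \<in> Poly_Mapping.keys (F V)" using b by (simp add: in_keys_iff)
    ultimately show "b \<in> (\<Union>V\<in>Pow {..<n}. (\<lambda>m. (m, V)) ` Poly_Mapping.keys (F V))"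
      using b(1) by blast
  qed
  then have "finite {b. to_form F b \<noteq> 0}" by (rule finite_subset) auto
  moreover have "Poly_Mapping.keys m \<subseteq> {..<n} \<and> V \<subseteq> {..<n}" if "to_form F (m, V) \<noteq> 0" for m V
  proof -
    have "F V \<noteq> 0" "m \<in> Poly_Mapping.keys (F V)" using that by (auto simp: to_form_def in_keys_iff)
    then show ?thesis using assms unfolding Families_def vars_in_def by blast
  qed
  ultimately show ?thesis unfolding Omega_def by blast
qed

lemma Families_unitf: "T \<subseteq> {..<n} \<Longrightarrow> f \<in> vars_in n \<Longrightarrow> unitf T f \<in> Families n"
  by (auto simp: Families_def unitf_def)

lemma Families_mult: "f \<in> vars_in n \<Longrightarrow> G \<in> Families n \<Longrightarrow> (\<lambda>V. f * G V) \<in> Families n"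
  by (auto simp: Families_def intro: vars_in_mult)

lemma Families_dwedge:
  assumes "\<And>i. g i \<in> vars_in n" "G \<in> Families n" shows "dwedge n g G \<in> Families n"
proof -
  have "dwedge n g G V = 0" if "\<not> V \<subseteq> {..<n}" for V
    unfolding dwedge_def
  proof (rule sum.neutral, rule ballI)
    fix i assume "i \<in> V \<inter> {..<n}"
    then have "\<not> V - {i} \<subseteq> {..<n}" using that by blast
    then show "Cst (wsign {i} (V - {i})) * (g i * G (V - {i})) = 0" 
      using assms(2) by (simp add: Families_def)
  qed
  moreover have "dwedge n g G V \<in> vars_in n" for V
    using assms unfolding dwedge_def Families_def
    by (intro vars_in_sum vars_in_mult vars_in_Cst) auto
  ultimately show ?thesis by (simp add: Families_def)
qed

lemma fwedge_unitf_empty: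
  assumes "\<And>V. infinite V \<Longrightarrow> G V = 0"
  shows "fwedge (unitf {} f) G = (\<lambda>V. f * G V)"
proof
  fix V
  show "fwedge (unitf {} f) G V = f * G V"
  proof (cases "finite V")
    case True
    have "fwedge (unitf {} f) G V = (\<Sum>S\<in>Pow V. if S = {} then f * G V else 0)"
      unfolding fwedge_def by (intro sum.cong) (auto simp: unitf_def)
    then show ?thesis using True by (simp add: sum.delta)
  qed (simp add: fwedge_def assms)
qed

lemma fwedge_oneform:
  assumes "\<And>V. infinite V \<Longrightarrow> G V = 0"
  shows "fwedge (oneform n g) G = dwedge n g G"
proof
  fix V
  show "fwedge (oneform n g) G V = dwedge n g G V"
  proof (cases "finite V")
    case True
    have "fwedge (oneform n g) G V
       = (\<Sum>S\<in>Pow V. \<Sum>i<n. if S = {i} then Cst (wsign {i} (V - {i})) * (g i * G (V - {i})) else 0)"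
      unfolding fwedge_def oneform_def sum_distrib_right sum_distrib_left
      by (intro sum.cong) (auto simp: unitf_def)
    also have "\<dots> = (\<Sum>i<n. \<Sum>S\<in>Pow V. if S = {i} then Cst (wsign {i} (V - {i})) * (g i * G (V - {i})) else 0)"
      by (rule sum.swap)
    also have "\<dots> = (\<Sum>i<n. if i \<in> V then Cst (wsign {i} (V - {i})) * (g i * G (V - {i})) else 0)"
      using True by (intro sum.cong) (auto simp: sum.delta)
    also have "\<dots> = dwedge n g G V"
      unfolding dwedge_def by (subst sum.inter_restrict[symmetric]) (auto simp: Int_commute)
    finally show ?thesis .
  next
    case False
    have "dwedge n g G V = 0" unfolding dwedge_def using False by (intro sum.neutral) (auto simp: assms)
    then show ?thesis using False by (simp add: fwedge_def)
  qed
qed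

section \<open>The generators of the ideal as families\<close>

lemma psum_eq_to_form:
  assumes "j \<ge> 1" shows "psum n j = to_form (unitf {} (powsum n j))"
proof (rule ext, clarify)
  fix m :: "nat \<Rightarrow>\<^sub>0 nat" and S :: "nat set"
  \<comment> \<open>This needs j > 0: for j = 0 the monomials coincide, giving coefficient n in
    \<open>powsum\<close> but only 1 in \<open>psum\<close>.\<close>
  have inj: "Poly_Mapping.single i j = Poly_Mapping.single i' j \<longleftrightarrow> i = i'" for i i'
  proof
    assume "Poly_Mapping.single i j = Poly_Mapping.single i' j"
    then have "Poly_Mapping.keys (Poly_Mapping.single i j) = Poly_Mapping.keys (Poly_Mapping.single i' j)"
      by (rule arg_cong)
    then show "i = i'" using assms by simp
  qed simp
  have "(\<Sum>i<n. Poly_Mapping.lookup (Poly_Mapping.single (Poly_Mapping.single i j) (1::complex)) m)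
      = (if m \<in> {Poly_Mapping.single i j | i. i < n} then 1 else 0)"
  proof (cases "\<exists>i<n. m = Poly_Mapping.single i j")
    case True
    then obtain i where i: "i < n" "m = Poly_Mapping.single i j" by blast
    have "(\<Sum>a<n. Poly_Mapping.lookup (Poly_Mapping.single (Poly_Mapping.single a j) (1::complex)) m)
       = (\<Sum>a<n. if a = i then 1 else 0)"
      unfolding i(2) by (intro sum.cong refl) (simp add: lookup_single inj when_def)
    also have "\<dots> = 1" using i(1) by (simp add: sum.delta)
    finally have "(\<Sum>i<n. Poly_Mapping.lookup (Poly_Mapping.single (Poly_Mapping.single i j) (1::complex)) m) = 1" .
    moreover have "m \<in> {Poly_Mapping.single i j | i. i < n}" using i by blast
    ultimately show ?thesis by (simp only: if_True)
  next
    case False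
    then have "(\<Sum>i<n. Poly_Mapping.lookup (Poly_Mapping.single (Poly_Mapping.single i j) (1::complex)) m) = 0"
      by (intro sum.neutral) (auto simp: lookup_single when_def)
    moreover have "m \<notin> {Poly_Mapping.single i j | i. i < n}" using False by blast
    ultimately show ?thesis by (simp only: if_False)
  qed
  then have "Poly_Mapping.lookup (powsum n j) m = (if m \<in> {Poly_Mapping.single i j | i. i < n} then 1 else 0)"
    unfolding powsum_def X_power lookup_sum .
  then show "psum n j (m, S) = to_form (unitf {} (powsum n j)) (m, S)"
    unfolding psum_def to_form_def unitf_def prod.case by (cases "S = {}") (simp_all only: simp_thms if_True if_False lookup_zero)
qed

lemma lookup_dpow:
  assumes "j \<ge> 1"
  shows "Poly_Mapping.lookup (dpow j i) m = (if m = Poly_Mapping.single i (j - 1) then of_nat j else 0)"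
  unfolding dpow_def of_nat_eq_Cst X_power by (simp only: lookup_Cst_mult lookup_single) (auto simp: when_def)

lemma ext_d_psum_eq_to_form:
  assumes "j \<ge> 1" shows "ext_d (psum n j) = to_form (oneform n (dpow j))"
proof (rule ext, clarify)
  fix m :: "nat \<Rightarrow>\<^sub>0 nat" and S :: "nat set"
  \<comment> \<open>The coefficient at x^m dx_i comes from x^m x_i, which must be the j-th power of
    one variable; as it contains x_i, it is x_i^j.\<close>
  have key: "m + Poly_Mapping.single i 1 \<in> {Poly_Mapping.single i' j | i'. i' < n}
      \<longleftrightarrow> i < n \<and> m = Poly_Mapping.single i (j - 1)" for i
  proof
    assume "m + Poly_Mapping.single i 1 \<in> {Poly_Mapping.single i' j | i'. i' < n}"
    then obtain i' where i': "i' < n" "m + Poly_Mapping.single i 1 = Poly_Mapping.single i' j" by blast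
    have "Poly_Mapping.lookup (m + Poly_Mapping.single i 1) i \<noteq> 0" by (simp add: lookup_add)
    then have "i' = i" unfolding i'(2) by (auto simp: lookup_single when_def split: if_splits)
    moreover have "m = Poly_Mapping.single i' j - Poly_Mapping.single i 1"
      using i'(2) by (metis add_diff_cancel_right')
    ultimately show "i < n \<and> m = Poly_Mapping.single i (j - 1)"
      using i'(1) by (simp flip: single_diff)
  next
    assume i: "i < n \<and> m = Poly_Mapping.single i (j - 1)"
    then have "m + Poly_Mapping.single i 1 = Poly_Mapping.single i j"
      using assms by (simp add: single_add[symmetric])
    then show "m + Poly_Mapping.single i 1 \<in> {Poly_Mapping.single i' j | i'. i' < n}"
      using i by blast
  qed
  have R: "to_form (oneform n (dpow j)) (m, S)
      = (\<Sum>i<n. if S = {i} \<and> m = Poly_Mapping.single i (j - 1) then of_nat j else 0)"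
    unfolding to_form_def oneform_def prod.case lookup_sum
    by (intro sum.cong) (auto simp: unitf_def lookup_dpow[OF assms])
  show "ext_d (psum n j) (m, S) = to_form (oneform n (dpow j)) (m, S)"
  proof (cases "\<exists>i. S = {i}")
    case True
    then obtain i where S: "S = {i}" by blast
    have "to_form (oneform n (dpow j)) (m, S)
      = (\<Sum>a<n. if a = i then (if m = Poly_Mapping.single i (j - 1) then of_nat j else 0) else 0)"
      unfolding R by (intro sum.cong) (auto simp: S)
    also have "\<dots> = (if i < n \<and> m = Poly_Mapping.single i (j - 1) then of_nat j else 0)"
      by (simp add: sum.delta)
    also have "\<dots> = of_nat (Poly_Mapping.lookup m i + 1) * psum n j (m + Poly_Mapping.single i 1, {})"
      unfolding psum_def prod.case key using assms by auto
    also have "\<dots> = ext_d (psum n j) (m, S)"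
      by (simp add: ext_d_def S)
    finally show ?thesis by simp
  next
    case False
    then have "ext_d (psum n j) (m, S) = 0"
      unfolding ext_d_def prod.case
    proof (intro sum.neutral ballI)
      fix i assume "i \<in> S"
      then have "S - {i} \<noteq> {}" using False by blast
      then show "wsign {i} (S - {i}) * of_nat (Poly_Mapping.lookup m i + 1)
          * psum n j (m + Poly_Mapping.single i 1, S - {i}) = 0" by (simp add: psum_def)
    qed
    moreover have "to_form (oneform n (dpow j)) (m, S) = 0"
      unfolding R using False by (intro sum.neutral) auto
    ultimately show ?thesis by simp
  qed
qed


subsection \<open>The upper bound\<close>

definition Ifam :: "nat \<Rightarrow> (nat set \<Rightarrow> cpoly) set" where
  "Ifam n = {F. to_form F \<in> Iideal n}"

lemma Ifam_add:
  assumes "F \<in> Ifam n" "G \<in> Ifam n" shows "(\<lambda>V. F V + G V) \<in> Ifam n"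
proof -
  have "to_form (\<lambda>V. F V + G V) = fadd (to_form F) (to_form G)"
    by (auto simp: to_form_def fadd_def lookup_add)
  then show ?thesis using assms by (simp add: Ifam_def Iideal_def gen_ideal.add)
qed

lemma wedge_generator_Ifam:
  assumes "g = unitf {} (powsum n j) \<or> g = oneform n (dpow j)" "1 \<le> j" "j \<le> n" "G \<in> Families n"
  shows "fwedge g G \<in> Ifam n"
proof -
  have g: "\<And>V. infinite V \<Longrightarrow> g V = 0" 
    using assms(1) by (auto simp: unitf_def oneform_def intro!: sum.neutral)
  \<comment> \<open>Generators are multiplied on both sides; the left factor is taken to be the
    constant form 1.\<close>
  have one: "\<And>V. infinite V \<Longrightarrow> unitf {} 1 V = 0" by (auto simp: unitf_def)
  have "to_form g \<in> {psum n j | j. 1 \<le> j \<and> j \<le> n} \<union> {ext_d (psum n j) | j. 1 \<le> j \<and> j \<le> n}"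
    using assms(1-3) psum_eq_to_form[OF assms(2)] ext_d_psum_eq_to_form[OF assms(2)] by auto
  moreover have "to_form (unitf {} 1) \<in> Omega n" by (intro to_form_Omega Families_unitf) auto
  moreover have "to_form G \<in> Omega n" by (rule to_form_Omega[OF assms(4)])
  ultimately have "wedge (wedge (to_form (unitf {} 1)) (to_form g)) (to_form G) \<in> Iideal n"
    unfolding Iideal_def by (rule gen_ideal.gen)
  then show ?thesis
    using g Families_infinite[OF assms(4)]
    by (simp add: Ifam_def wedge_to_form[OF one g] fwedge_unitf_empty wedge_to_form)
qed

lemma Ifam_powsum:
  assumes "1 \<le> j" "j \<le> n" "G \<in> Families n" shows "(\<lambda>V. powsum n j * G V) \<in> Ifam n"
  using wedge_generator_Ifam[of "unitf {} (powsum n j)" n j G] assms Families_infinite[OF assms(3)]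
  by (simp add: fwedge_unitf_empty)

lemma Ifam_dpow:
  assumes "1 \<le> j" "j \<le> n" "G \<in> Families n" shows "dwedge n (dpow j) G \<in> Ifam n"
  using wedge_generator_Ifam[of "oneform n (dpow j)" n j G] assms Families_infinite[OF assms(3)]
  by (simp add: fwedge_oneform)

text \<open>The inductive ideal has no rule for 0; it arises as a multiple of p_1, which is a
  generator since n is positive.\<close>

lemma Ifam_0: "n \<ge> 1 \<Longrightarrow> (\<lambda>V. 0) \<in> Ifam n"
  using Ifam_powsum[of 1 n "\<lambda>V. 0"] by (simp add: Families_def)

lemma Ifam_sum:
  assumes "n \<ge> 1" "\<And>a. a \<in> A \<Longrightarrow> F a \<in> Ifam n" shows "(\<lambda>V. \<Sum>a\<in>A. F a V) \<in> Ifam n"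
  using assms(2) by (induction A rule: infinite_finite_induct) (auto intro: Ifam_add Ifam_0[OF assms(1)])

lemma dwedge_cong: "(\<And>i. i < n \<Longrightarrow> f i = g i) \<Longrightarrow> dwedge n f G = dwedge n g G"
  by (auto simp: dwedge_def intro!: sum.cong)

lemma dwedge_add: "dwedge n (\<lambda>i. f i + g i) G V = dwedge n f G V + dwedge n g G V"
  by (simp add: dwedge_def distrib_left distrib_right sum.distrib)

lemma dwedge_mult: "dwedge n (\<lambda>i. f i * h) G = dwedge n f (\<lambda>V. h * G V)"
  by (simp add: dwedge_def mult_ac fun_eq_iff)

lemma dwedge_mult_right: "dwedge n f (\<lambda>V. h * G V) V = h * dwedge n f G V"
  by (simp add: dwedge_def mult_ac sum_distrib_left)

section \<open>Polynomials lying in the ideal together with their differentials\<close>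

text \<open>Asking for both g and dg still gives an ideal of polynomials, because d(f g) = g df + f
  dg.\<close>

definition Jd :: "nat \<Rightarrow> cpoly set" where
  "Jd n = {g \<in> vars_in n. \<forall>G\<in>Families n. (\<lambda>V. g * G V) \<in> Ifam n \<and> dwedge n (\<lambda>i. pderivm i g) G \<in> Ifam n}"

lemma Jd_0: "n \<ge> 1 \<Longrightarrow> 0 \<in> Jd n"
  using Ifam_0 by (simp add: Jd_def dwedge_def[abs_def])

lemma Jd_add: "f \<in> Jd n \<Longrightarrow> g \<in> Jd n \<Longrightarrow> f + g \<in> Jd n"
  using Ifam_add[of _ n]
  by (fastforce simp: Jd_def vars_in_add pderivm_add dwedge_add[abs_def] distrib_right)

lemma Jd_sum: "n \<ge> 1 \<Longrightarrow> (\<And>a. a \<in> A \<Longrightarrow> f a \<in> Jd n) \<Longrightarrow> sum f A \<in> Jd n"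
  by (induction A rule: infinite_finite_induct) (auto intro: Jd_0 Jd_add)

lemma Jd_mult:
  assumes "f \<in> vars_in n" "g \<in> Jd n" shows "f * g \<in> Jd n"
proof -
  have pderivm_fg: "pderivm i (f * g) = pderivm i f * g + pderivm i g * f" for i
    by (simp add: pderivm_mult)
  have "(\<lambda>V. f * g * G V) \<in> Ifam n \<and> dwedge n (\<lambda>i. pderivm i (f * g)) G \<in> Ifam n" if G: "G \<in> Families n" for G
  proof
    have fG: "(\<lambda>V. f * G V) \<in> Families n" using Families_mult assms(1) G by blast
    then have "(\<lambda>V. g * (f * G V)) \<in> Ifam n" using assms(2) by (simp add: Jd_def)
    then show "(\<lambda>V. f * g * G V) \<in> Ifam n" by (simp add: mult_ac)
    have "dwedge n (\<lambda>i. pderivm i f) G \<in> Families n"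
      by (intro Families_dwedge vars_in_pderivm assms G)
    then have 1: "(\<lambda>V. g * dwedge n (\<lambda>i. pderivm i f) G V) \<in> Ifam n" using assms(2) by (simp add: Jd_def)
    have 2: "dwedge n (\<lambda>i. pderivm i g) (\<lambda>V. f * G V) \<in> Ifam n" using fG assms(2) by (simp add: Jd_def)
    have "dwedge n (\<lambda>i. pderivm i (f * g)) G
        = (\<lambda>V. g * dwedge n (\<lambda>i. pderivm i f) G V + dwedge n (\<lambda>i. pderivm i g) (\<lambda>V. f * G V) V)"
      by (simp only: pderivm_fg dwedge_add[abs_def] dwedge_mult dwedge_mult_right)
    then show "dwedge n (\<lambda>i. pderivm i (f * g)) G \<in> Ifam n" using Ifam_add[OF 1 2] by simp
  qed
  then show ?thesis using assms by (simp add: Jd_def vars_in_mult)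
qed

lemma Jd_powsum:
  assumes "1 \<le> j" "j \<le> n" shows "powsum n j \<in> Jd n"
proof -
  have d: "pderivm i (powsum n j) = dpow j i" if "i < n" for i
  proof -
    obtain j' where j: "j = Suc j'" using assms(1) by (cases j) auto
    have "pderivm i (powsum n j) = (\<Sum>s<n. if i = s then of_nat (Suc j') * Xv s ^ j' else 0)"
      unfolding powsum_def pderivm_sum j pderivm_X_power ..
    also have "\<dots> = dpow j i" using that by (simp add: dpow_def j sum.delta' del: of_nat_Suc)
    finally show ?thesis .
  qed
  have "powsum n j \<in> vars_in n" unfolding powsum_def by (intro vars_in_sum vars_in_power vars_in_X) auto
  moreover have "dwedge n (\<lambda>i. pderivm i (powsum n j)) G = dwedge n (dpow j) G" for G
    by (rule dwedge_cong) (rule d)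
  ultimately show ?thesis using Ifam_powsum Ifam_dpow assms by (simp add: Jd_def)
qed

lemma Hom_vars_in: "f \<in> Hom A m \<Longrightarrow> A \<subseteq> {..<n} \<Longrightarrow> f \<in> vars_in n"
  by (induction rule: Hom_induct) (auto intro: vars_in_Cst vars_in_mult vars_in_X vars_in_add)

lemma hsym_vars_in:
  assumes "A \<subseteq> {..<n}" shows "hsym Xv A m \<in> vars_in n"
proof (cases "A = {}")
  case True then show ?thesis by (cases m) auto
next
  case False
  moreover have "finite A" using assms finite_subset by blast
  ultimately show ?thesis by (intro Hom_vars_in[OF Hom_hsym assms])
qed

text \<open>Newton's identity expresses m h_m through p_1, ..., p_m, all of them generators as m is
  at most n, and m is invertible.\<close>

lemma Jd_hsym_all:
  assumes "1 \<le> m" "m \<le> n" shows "hsym Xv {..<n} m \<in> Jd n"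
proof -
  obtain k where m: "m = Suc k" using assms(1) by (cases m) auto
  have "(\<Sum>i\<le>k. hsym Xv {..<n} (k - i) * powsum n (Suc i)) \<in> Jd n"
    using assms m by (intro Jd_sum Jd_mult hsym_vars_in Jd_powsum) auto
  also have "(\<Sum>i\<le>k. hsym Xv {..<n} (k - i) * powsum n (Suc i)) = of_nat m * hsym Xv {..<n} m"
    using hsym_newton[of "{..<n}" k Xv] m by (simp add: powsum_def mult.commute)
  finally have "Cst (inverse (of_nat m)) * (of_nat m * hsym Xv {..<n} m) \<in> Jd n"
    by (rule Jd_mult[OF vars_in_Cst])
  then show ?thesis using assms(1) unfolding of_nat_eq_Cst by (subst (asm) Cst_inverse_cancel) auto
qed

text \<open>Variables are removed one by one through h_m(A) = h_m(A + t) - x_t h_{m-1}(A + t); the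
  index m - 1 is why each removal raises the least admissible degree by one.\<close>

lemma Jd_hsym:
  assumes "A \<subseteq> {..<n}" "n - card A < m" "m \<le> n" shows "hsym Xv A m \<in> Jd n"
  using assms
proof (induction "n - card A" arbitrary: A m)
  case 0
  then have "card A = n" using card_mono[of "{..<n}" A] by auto
  then have "A = {..<n}" using 0 by (simp add: card_subset_eq)
  then show ?case using Jd_hsym_all 0 by simp
next
  case (Suc k)
  then have "A \<noteq> {..<n}" by auto
  then obtain t where t: "t < n" "t \<notin> A" using Suc.prems(1) by auto
  have fin: "finite A" using Suc.prems(1) finite_subset by blast
  obtain m' where m: "m = Suc m'" using Suc.prems by (cases m) auto
  have c: "n - card (insert t A) = k" using Suc.hyps(2) fin t by simp
  have "hsym Xv (insert t A) m \<in> Jd n" using c Suc t by (intro Suc.hyps(1)) auto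
  moreover have "hsym Xv (insert t A) m' \<in> Jd n" using c Suc t m by (intro Suc.hyps(1)) auto
  ultimately have "hsym Xv (insert t A) m + (Cst (-1) * Xv t) * hsym Xv (insert t A) m' \<in> Jd n"
    using t by (intro Jd_add Jd_mult vars_in_mult vars_in_Cst vars_in_X) auto
  then show ?case using hsym_insert[OF fin t(2), of Xv m'] m by (simp add: single_uminus)
qed

section \<open>Annihilators of dx_S modulo the ideal\<close>

text \<open>The multiplier g is built in so that closure under multiplication is immediate.\<close>

definition Ann :: "nat \<Rightarrow> nat set \<Rightarrow> cpoly set" where
  "Ann n S = {f \<in> vars_in n. \<forall>g\<in>vars_in n. unitf S (f * g) \<in> Ifam n}"

lemma unitf_add: "unitf S (f + g) = (\<lambda>V. unitf S f V + unitf S g V)"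
  by (auto simp: unitf_def)

lemma gideal_Ann:
  assumes "n \<ge> 1" shows "gideal {..<n} (\<lambda>m. Ann n S)"
proof (rule gidealI)
  have "unitf S 0 = (\<lambda>V. 0)" by (auto simp: unitf_def)
  then show "0 \<in> Ann n S" using Ifam_0[OF assms] by (simp add: Ann_def)
  show "f + g \<in> Ann n S" if "f \<in> Ann n S" "g \<in> Ann n S" for f g
    using that by (auto simp: Ann_def vars_in_add distrib_right unitf_add intro: Ifam_add)
  show "c * f \<in> Ann n S" if "f \<in> Ann n S" "c \<in> Hom {..<n} k" for f c k
  proof -
    have c: "c \<in> vars_in n" using that(2) by (rule Hom_vars_in) simp
    have "unitf S (f * (c * g)) \<in> Ifam n" if "g \<in> vars_in n" for g
      using \<open>f \<in> Ann n S\<close> vars_in_mult[OF c that] by (simp add: Ann_def)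
    then show ?thesis using that c by (simp add: Ann_def vars_in_mult mult_ac)
  qed
qed

lemma Ann_Jd: 
  assumes "S \<subseteq> {..<n}" "f \<in> Jd n" shows "f \<in> Ann n S"
proof -
  have "unitf S (f * g) \<in> Ifam n" if "g \<in> vars_in n" for g
  proof -
    have "(\<lambda>V. f * unitf S g V) \<in> Ifam n" 
      using assms Families_unitf[OF assms(1) that] by (simp add: Jd_def)
    moreover have "(\<lambda>V. f * unitf S g V) = unitf S (f * g)" by (auto simp: unitf_def)
    ultimately show ?thesis by simp
  qed
  then show ?thesis using assms by (simp add: Ann_def Jd_def)
qed

text \<open>Wedging \<open>d h\<^sub>d\<^sub>+\<^sub>1(x\<^sub>S)\<close> with \<open>dx\<^bsub>S - {s}\<^esub>\<close> leaves only the \<open>dx\<^sub>s\<close> component.\<close>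
lemma Ann_hsymd:
  assumes "S \<subseteq> {..<n}" "s \<in> S" "d = n - card S" shows "hsymd Xv S s d \<in> Ann n S"
proof -
  have fin: "finite S" using assms(1) finite_subset by blast
  have card: "0 < card S" "card S \<le> n" 
    using assms(1,2) fin card_mono[of "{..<n}" S] by (auto simp: card_gt_0_iff)
  let ?h = "hsym Xv S (Suc d)"
  \<comment> \<open>The degree n - |S| + 1 is the least that \<open>Jd_hsym\<close> admits, and it
    is at most n because S contains s.\<close>
  have h: "?h \<in> Jd n" using assms card by (intro Jd_hsym) auto
  let ?w = "wsign {s} (S - {s})"
  have "unitf S (hsymd Xv S s d * g) \<in> Ifam n" if g: "g \<in> vars_in n" for g
  proof -
    \<comment> \<open>The factor \<open>?w\<close> cancels the sign of dx_s wedge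
      dx_{S-{s}}.\<close>
    let ?G = "unitf (S - {s}) (Cst ?w * g)"
    have "?G \<in> Families n" using assms g by (intro Families_unitf vars_in_mult vars_in_Cst) auto
    then have "dwedge n (\<lambda>i. pderivm i ?h) ?G \<in> Ifam n" using h by (simp add: Jd_def)
    moreover have "dwedge n (\<lambda>i. pderivm i ?h) ?G = unitf S (hsymd Xv S s d * g)"
    proof
      fix V
      have "dwedge n (\<lambda>i. pderivm i ?h) ?G V = (\<Sum>i\<in>V \<inter> {..<n}. if i = s then unitf S (hsymd Xv S s d * g) V else 0)"
        unfolding dwedge_def
      proof (intro sum.cong refl)
        fix i assume i: "i \<in> V \<inter> {..<n}"
        show "Cst (wsign {i} (V - {i})) * (pderivm i ?h * ?G (V - {i})) = (if i = s then unitf S (hsymd Xv S s d * g) V else 0)"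
        proof (cases "i = s")
          case True
          have "Cst ?w * (hsymd Xv S s d * (Cst ?w * g)) = (Cst ?w * Cst ?w) * (hsymd Xv S s d * g)"
            by (simp only: mult_ac)
          also have "\<dots> = hsymd Xv S s d * g" by (simp add: mult_single wsign_square)
          finally have "Cst ?w * (hsymd Xv S s d * (Cst ?w * g)) = hsymd Xv S s d * g" .
          moreover have "V - {s} = S - {s} \<longleftrightarrow> V = S" using True i assms(2) by blast
          ultimately show ?thesis using True assms(2) fin by (auto simp: unitf_def pderivm_hsym)
        next
          case False
          \<comment> \<open>For i outside S the derivative is 0; for i in S other than s, the set S
            - {s} contains i but V - {i} does not.\<close>
          have "pderivm i ?h * ?G (V - {i}) = 0"
          proof (cases "i \<in> S")
            case True
            then have "V - {i} \<noteq> S - {s}" using False by blast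
            then show ?thesis by (simp add: unitf_def)
          qed (simp add: pderivm_hsym_other fin)
          then show ?thesis using False by simp
        qed
      qed
      also have "\<dots> = (if s \<in> V \<inter> {..<n} then unitf S (hsymd Xv S s d * g) V else 0)"
        by (simp add: sum.delta)
      also have "\<dots> = unitf S (hsymd Xv S s d * g) V" using assms by (auto simp: unitf_def)
      finally show "dwedge n (\<lambda>i. pderivm i ?h) ?G V = unitf S (hsymd Xv S s d * g) V" .
    qed
    ultimately show ?thesis by simp
  qed
  moreover have "hsymd Xv S s d \<in> vars_in n"
    using assms(1,2) by (auto simp: hsymd_eq_sum intro!: vars_in_sum vars_in_mult vars_in_power vars_in_X hsym_vars_in)
  ultimately show ?thesis by (simp add: Ann_def)
qed

text \<open>Induction on B: the partial derivatives of h settle the variables of S, and each further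
  variable costs \<open>n - Suc j\<close>, where j counts the variables already present.\<close>

lemma Hom_subset_Ann:
  assumes "n \<ge> 1" "S \<subseteq> {..<n}" "card S = k" "finite B" "B \<subseteq> {..<n} - S"
    "int m > int k * (int (n - k) - 1) + (\<Sum>j = k..<k + card B. int (n - Suc j))"
  shows "Hom (S \<union> B) m \<subseteq> Ann n S"
  using assms(4-)
proof (induction B arbitrary: m rule: finite_induct)
  case empty
  have "Hom S m \<subseteq> (\<lambda>m. Ann n S) m"
  proof (rule Hom_subset_hsymd[where d = "n - k"])
    show "finite S" using assms(2) finite_subset by blast
    show "gideal S (\<lambda>m. Ann n S)" by (rule gideal_subset[OF gideal_Ann[OF assms(1)] assms(2)])
    show "hsymd Xv S s (n - k) \<in> Ann n S" if "s \<in> S" for s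
      using Ann_hsymd[OF assms(2) that] assms(3) by blast
    show "int (card S) * (int (n - k) - 1) < int m" using empty assms(3) by simp
  qed
  then show ?case by simp
next
  case (insert t B)
  have fin: "finite S" using assms(2) finite_subset by blast
  have sub: "insert t (S \<union> B) \<subseteq> {..<n}" and t: "t \<notin> S \<union> B" and disj: "S \<inter> B = {}"
    using insert.prems(1) insert.hyps(2) assms(2) by blast+
  have c: "card (insert t (S \<union> B)) = Suc (k + card B)"
    using insert.hyps(1) fin assms(3) t disj by (simp add: card_Un_disjoint)
  have le: "card (insert t (S \<union> B)) \<le> n"
    using card_mono[OF _ sub] by simp
  \<comment> \<open>Then \<open>Suc ?e\<close> is n + 1 minus the number of variables in
    \<open>insert t (S \<union> B)\<close>, the least degree in which their h is known to lie in the
    ideal.\<close>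
  let ?e = "n - Suc (k + card B)"
  let ?N = "int k * (int (n - k) - 1) + (\<Sum>j = k..<k + card B. int (n - Suc j))"
  have "Hom (insert t (S \<union> B)) m \<subseteq> (\<lambda>m. Ann n S) m"
  proof (rule Hom_insert_subset[where e = ?e and N = ?N])
    show "gideal (insert t (S \<union> B)) (\<lambda>m. Ann n S)"
      by (rule gideal_subset[OF gideal_Ann[OF assms(1)] sub])
    show "hsym Xv (insert t (S \<union> B)) (Suc ?e) \<in> Ann n S"
      using c le by (intro Ann_Jd[OF assms(2)] Jd_hsym[OF sub]) linarith+
    show "Hom (S \<union> B) m \<subseteq> Ann n S" if "?N < int m" for m
      using insert.IH[OF _ that] insert.prems(1) by blast
    have "(\<Sum>j = k..<k + card (insert t B). int (n - Suc j))
        = (\<Sum>j = k..<k + card B. int (n - Suc j)) + int ?e"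
      using insert.hyps by simp
    then show "?N + int ?e < int m" using insert.prems(2) by linarith
    show "finite (S \<union> B)" using fin insert.hyps(1) by blast
    show "t \<notin> S \<union> B" by (rule t)
  qed
  then show ?case by simp
qed

section \<open>The degree bound and the components of a form\<close>

lemma two_choose_two: "2 * int (a choose 2) = int a * (int a - 1)"
proof -
  have "even (a * (a - 1))" by (cases "even a") auto
  then have "2 * (a choose 2) = a * (a - 1)" unfolding choose_two by (rule dvd_mult_div_cancel)
  then have "2 * int (a choose 2) = int (a * (a - 1))" by linarith
  then show ?thesis by (cases a) (auto simp: algebra_simps)
qed

text \<open>With n = k + r both sides equal k(r-1) + r(r-1)/2. The integers are essential: for k = n
  the value is -n.\<close>

lemma top_degree_eq:
  assumes "k \<le> n"
  shows "int k * (int (n - k) - 1) + (\<Sum>j = k..<n. int (n - Suc j)) = int (n choose 2) - int ((k + 1) choose 2)"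
proof -
  obtain r where n: "n = k + r" using assms le_Suc_ex by blast
  have "(\<Sum>j = k..<k + r. int (k + r - Suc j)) = (\<Sum>j<r. int (r - Suc j))"
    by (rule sum.reindex_bij_witness[of _ "\<lambda>j. j + k" "\<lambda>j. j - k"]) auto
  also have "\<dots> = (\<Sum>j<r. int j)" by (subst sum.nat_diff_reindex[symmetric]) simp
  also have "2 * \<dots> = int r * (int r - 1)" by (induction r) (auto simp: algebra_simps)
  finally have "2 * (\<Sum>j = k..<n. int (n - Suc j)) = int r * (int r - 1)" by (simp add: n)
  moreover have "2 * int (n choose 2) = int (k + r) * (int (k + r) - 1)" 
    "2 * int ((k + 1) choose 2) = int (k + 1) * int k"
    using two_choose_two[of n] two_choose_two[of "k + 1"] n by simp_all
  ultimately show ?thesis by (simp add: n algebra_simps)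
qed

lemma mdeg_eq_sum: 
  assumes "Poly_Mapping.keys m \<subseteq> A" "finite A" shows "mdeg m = (\<Sum>i\<in>A. Poly_Mapping.lookup m i)"
  unfolding mdeg_def using assms by (intro sum.mono_neutral_left) (auto simp: in_keys_iff)

lemma single_in_Hom:
  assumes "Poly_Mapping.keys m \<subseteq> {..<n}" shows "Poly_Mapping.single m c \<in> Hom {..<n} (mdeg m)"
  using assms
proof (induction "mdeg m" arbitrary: m)
  case 0
  have "Poly_Mapping.lookup m i = 0" for i
    using 0 by (cases "i \<in> Poly_Mapping.keys m") (auto simp: mdeg_def in_keys_iff)
  then have "m = 0" by (intro poly_mapping_eqI) simp
  then show ?case using Hom_Cst[of c "{..<n}"] by (simp add: mdeg_def)
next
  case (Suc d)
  have "m \<noteq> 0" using Suc.hyps(2) by (auto simp: mdeg_def)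
  then obtain i where i: "i \<in> Poly_Mapping.keys m" by (metis equals0I keys_eq_empty)
  define m' where "m' = m - Poly_Mapping.single i 1"
  have m: "m = Poly_Mapping.single i 1 + m'"
    using i by (intro poly_mapping_eqI) (auto simp: m'_def lookup_add lookup_minus lookup_single when_def in_keys_iff)
  have sub: "Poly_Mapping.keys m' \<subseteq> {..<n}"
  proof
    fix x assume "x \<in> Poly_Mapping.keys m'"
    then have "x \<in> Poly_Mapping.keys m" by (auto simp: m'_def in_keys_iff lookup_minus)
    then show "x \<in> {..<n}" using Suc.prems by blast
  qed
  have "mdeg m = (\<Sum>a<n. (if a = i then 1 else 0) + Poly_Mapping.lookup m' a)"
    unfolding mdeg_eq_sum[OF Suc.prems finite_lessThan]
    by (intro sum.cong refl) (subst m, auto simp: lookup_add lookup_single when_def)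
  also have "\<dots> = Suc (mdeg m')"
    using i Suc.prems unfolding mdeg_eq_sum[OF sub finite_lessThan] sum.distrib by (simp add: subset_iff)
  finally have d: "mdeg m = Suc (mdeg m')" .
  then have "Poly_Mapping.single m' c \<in> Hom {..<n} (mdeg m')" using Suc.hyps sub by auto
  then have "Xv i * Poly_Mapping.single m' c \<in> Hom {..<n} (Suc (mdeg m'))"
    using i Suc.prems by (intro Hom_X) auto
  then show ?case unfolding d by (simp add: Xv_def mult_single m)
qed

lemma in_HomI:
  assumes "n \<ge> 1" "f \<in> vars_in n" "\<And>m. m \<in> Poly_Mapping.keys f \<Longrightarrow> mdeg m = l"
  shows "f \<in> Hom {..<n} l"
proof (cases "f = 0")
  case True then show ?thesis using Hom_0[of "{..<n}" l] assms(1) by (auto simp: lessThan_empty_iff)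
next
  case False
  have "f = (\<Sum>m\<in>Poly_Mapping.keys f. Poly_Mapping.single m (Poly_Mapping.lookup f m))"
    by (rule poly_mapping_eqI) (auto simp: lookup_sum lookup_single when_def in_keys_iff sum.delta)
  also have "\<dots> \<in> Hom {..<n} l"
  proof (rule Hom_sum)
    fix m assume m: "m \<in> Poly_Mapping.keys f"
    then show "Poly_Mapping.single m (Poly_Mapping.lookup f m) \<in> Hom {..<n} l"
      using single_in_Hom[of m n] assms(2) assms(3)[OF m] by (auto simp: vars_in_def)
  qed (use False in auto)
  finally show ?thesis .
qed

lemma Omega_lk_subset_Iideal:
  assumes "n \<ge> 1" "k \<le> n" "\<omega> \<in> Omega_lk n l k" "int l > int (n choose 2) - int ((k + 1) choose 2)"
  shows "\<omega> \<in> Iideal n"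
proof -
  have om: "\<omega> \<in> Omega n" and deg: "\<And>m V. \<omega> (m, V) \<noteq> 0 \<Longrightarrow> mdeg m = l \<and> card V = k"
    using assms(3) unfolding Omega_lk_def by blast+
  let ?F = "coeff_family \<omega>"
  have F: "to_form ?F = \<omega>" "?F \<in> Families n" using to_form_coeff_family[OF om] by auto
  have l: "Poly_Mapping.lookup (?F V) m = \<omega> (m, V)" for V m
    using fun_cong[OF F(1), of "(m, V)"] by (simp add: to_form_def)
  \<comment> \<open>A form is the sum of its components f dx_S, so each is treated alone, with all
    variables outside S adjoined.\<close>
  have unit: "unitf S (?F S) \<in> Ifam n" if S: "S \<subseteq> {..<n}" for S
  proof (cases "card S = k")
    case True
    have "?F S \<in> vars_in n" using F(2) by (simp add: Families_def)
    moreover have "mdeg m = l" if "m \<in> Poly_Mapping.keys (?F S)" for m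
      using that deg[of m S] by (simp add: in_keys_iff l)
    ultimately have "?F S \<in> Hom {..<n} l" by (intro in_HomI assms(1))
    moreover have fin: "finite S" using S finite_subset by blast
    moreover have "Hom (S \<union> ({..<n} - S)) l \<subseteq> Ann n S"
    proof (rule Hom_subset_Ann[OF assms(1) S True])
      have "card ({..<n} - S) = n - k" using True S fin by (simp add: card_Diff_subset)
      then have "k + card ({..<n} - S) = n" using assms(2) by simp
      then show "int k * (int (n - k) - 1) + (\<Sum>j = k..<k + card ({..<n} - S). int (n - Suc j)) < int l"
        using assms(4) top_degree_eq[OF assms(2)] by simp
    qed auto
    moreover have "S \<union> ({..<n} - S) = {..<n}" using S by blast
    ultimately have "?F S \<in> Ann n S" by auto
    then have "unitf S (?F S * 1) \<in> Ifam n" unfolding Ann_def using vars_in_1 by blast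
    then show ?thesis by simp
  next
    case False
    then have "?F S = 0" using deg[of _ S] by (intro poly_mapping_eqI) (auto simp: l)
    then have "unitf S (?F S) = (\<lambda>V. 0)" by (auto simp: unitf_def)
    then show ?thesis using Ifam_0[OF assms(1)] by simp
  qed
  have "(\<lambda>V. \<Sum>S\<in>Pow {..<n}. unitf S (?F S) V) \<in> Ifam n"
    by (rule Ifam_sum[OF assms(1)]) (use unit in auto)
  moreover have "(\<lambda>V. \<Sum>S\<in>Pow {..<n}. unitf S (?F S) V) = ?F"
  proof
    fix V
    have "(\<Sum>S\<in>Pow {..<n}. unitf S (?F S) V) = (\<Sum>S\<in>Pow {..<n}. if S = V then ?F V else 0)"
      by (intro sum.cong) (auto simp: unitf_def)
    also have "\<dots> = ?F V" using F(2) by (auto simp: sum.delta Families_def)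
    finally show "(\<Sum>S\<in>Pow {..<n}. unitf S (?F S) V) = ?F V" .
  qed
  ultimately show ?thesis using F(1) by (simp add: Ifam_def)
qed


subsection \<open>The lower bound\<close>

lemma wsign_singleton: "wsign {i} V = (-1) ^ card {j \<in> V. j < i}"
proof -
  have "{(a, b). a \<in> {i} \<and> b \<in> V \<and> b < a} = Pair i ` {j \<in> V. j < i}" by auto
  then show ?thesis unfolding wsign_def by (simp add: card_image inj_on_def)
qed

lemma wsign_singleton_insert:
  assumes "l \<notin> W" shows "wsign {i} (insert l W) = wsign {i} W * (if l < i then -1 else 1)"
proof (cases "l < i")
  case True
  then have "{j \<in> insert l W. j < i} = insert l {j \<in> W. j < i}" by auto
  then show ?thesis using True assms by (simp add: wsign_singleton)
next
  case False
  then have "{j \<in> insert l W. j < i} = {j \<in> W. j < i}" by auto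
  then show ?thesis using False by (simp add: wsign_singleton)
qed

lemma finite_wsign_set: "finite S \<Longrightarrow> finite {(a, b :: nat). a \<in> S \<and> b \<in> T \<and> b < a}"
  by (rule finite_subset[of _ "SIGMA a:S. {..<a}"]) auto

lemma wsign_Un_left:
  assumes "finite S" "finite S'" "S \<inter> S' = {}" shows "wsign (S \<union> S') T = wsign S T * wsign S' T"
proof -
  have "{(a, b). a \<in> S \<union> S' \<and> b \<in> T \<and> b < a}
      = {(a, b). a \<in> S \<and> b \<in> T \<and> b < a} \<union> {(a, b). a \<in> S' \<and> b \<in> T \<and> b < a}" by auto
  moreover have "card \<dots> = card {(a, b). a \<in> S \<and> b \<in> T \<and> b < a} + card {(a, b). a \<in> S' \<and> b \<in> T \<and> b < a}"
    using assms by (intro card_Un_disjoint finite_wsign_set) auto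
  ultimately show ?thesis unfolding wsign_def by (simp add: power_add)
qed

lemma wsign_Un_right:
  assumes "finite S" "T \<inter> T' = {}" shows "wsign S (T \<union> T') = wsign S T * wsign S T'"
proof -
  have "{(a, b). a \<in> S \<and> b \<in> T \<union> T' \<and> b < a}
      = {(a, b). a \<in> S \<and> b \<in> T \<and> b < a} \<union> {(a, b). a \<in> S \<and> b \<in> T' \<and> b < a}" by auto
  moreover have "card \<dots> = card {(a, b). a \<in> S \<and> b \<in> T \<and> b < a} + card {(a, b). a \<in> S \<and> b \<in> T' \<and> b < a}"
    using assms by (intro card_Un_disjoint finite_wsign_set) auto
  ultimately show ?thesis unfolding wsign_def by (simp add: power_add)
qed

text \<open>The elements of W above i and those below i together make up W.\<close>

lemma wsign_singleton_right:
  assumes "finite W" "i \<notin> W" shows "wsign W {i} = (-1) ^ card W * wsign {i} W"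
proof -
  have "{(a, b). a \<in> W \<and> b \<in> {i} \<and> b < a} = (\<lambda>a. (a, i)) ` {a \<in> W. i < a}" by auto
  then have 1: "wsign W {i} = (-1) ^ card {a \<in> W. i < a}"
    unfolding wsign_def by (simp add: card_image inj_on_def)
  have "W = {a \<in> W. i < a} \<union> {a \<in> W. a < i}"
  proof (rule set_eqI)
    fix x show "x \<in> W \<longleftrightarrow> x \<in> {a \<in> W. i < a} \<union> {a \<in> W. a < i}"
      using assms(2) by (cases x i rule: linorder_cases) auto
  qed
  then have "card W = card ({a \<in> W. i < a} \<union> {a \<in> W. a < i})" by (rule arg_cong)
  also have "\<dots> = card {a \<in> W. i < a} + card {a \<in> W. a < i}"
    using assms(1) by (intro card_Un_disjoint) auto
  finally have c: "card W = card {a \<in> W. i < a} + card {a \<in> W. a < i}" .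
  show ?thesis unfolding 1 wsign_singleton c
    by (simp add: power_add mult.assoc power_mult_distrib[symmetric])
qed

text \<open>Contraction with the vector field \<open>\<Sum>\<^sub>i x\<^sub>i\<^sup>a \<partial>\<^sub>i\<close>.\<close>
definition contract :: "nat \<Rightarrow> nat \<Rightarrow> (nat set \<Rightarrow> cpoly) \<Rightarrow> nat set \<Rightarrow> cpoly" where
  "contract n a F V = (\<Sum>i\<in>{..<n} - V. Cst (wsign {i} V) * (Xv i ^ a * F (insert i V)))"

lemma Cst_wsign_square: "Cst (wsign S T) * Cst (wsign S T) = 1"
  by (simp add: mult_single wsign_square)

text \<open>Contraction is an antiderivation, so contracting and wedging with a one-form anticommute
  up to the value of the one-form on the vector field. The diagonal terms with i outside V come from
  the first summand, those with i in V from the second, and the mixed terms \<open>?t i l\<close>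
  cancel.\<close>

lemma contract_dwedge:
  "contract n a (dwedge n g G) V + dwedge n g (contract n a G) V = (\<Sum>i<n. Xv i ^ a * g i) * G V"
proof -
  let ?P = "{..<n} - V" and ?Q = "V \<inter> {..<n}"
  let ?t = "\<lambda>i l. Cst (wsign {i} V * wsign {l} (insert i V - {l})) * (Xv i ^ a * (g l * G (insert i V - {l})))"
  have "contract n a (dwedge n g G) V = (\<Sum>i\<in>?P. Xv i ^ a * g i * G V + (\<Sum>l\<in>?Q. ?t i l))"
    unfolding contract_def dwedge_def
  proof (intro sum.cong refl)
    fix i assume i: "i \<in> ?P"
    have "insert i V \<inter> {..<n} = insert i ?Q" "i \<notin> ?Q" "insert i V - {i} = V" using i by auto
    then have h1: "(\<Sum>l\<in>insert i V \<inter> {..<n}. Cst (wsign {l} (insert i V - {l})) * (g l * G (insert i V - {l})))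
       = Cst (wsign {i} V) * (g i * G V)
         + (\<Sum>l\<in>?Q. Cst (wsign {l} (insert i V - {l})) * (g l * G (insert i V - {l})))"
      by simp
    have h2: "Cst (wsign {i} V) * (Xv i ^ a * (Cst (wsign {i} V) * (g i * G V)))
        = (Cst (wsign {i} V) * Cst (wsign {i} V)) * (Xv i ^ a * g i * G V)" by (simp only: mult_ac)
    have h3: "Cst (wsign {i} V) * (Xv i ^ a * (Cst (wsign {l} (insert i V - {l})) * (g l * G (insert i V - {l}))))
        = ?t i l" for l
    proof -
      have "?t i l = (Cst (wsign {i} V) * Cst (wsign {l} (insert i V - {l}))) * (Xv i ^ a * (g l * G (insert i V - {l})))"
        by (simp add: mult_single)
      then show ?thesis by (simp only: mult_ac)
    qed
    show "Cst (wsign {i} V) * (Xv i ^ a * (\<Sum>l\<in>insert i V \<inter> {..<n}. Cst (wsign {l} (insert i V - {l})) * (g l * G (insert i V - {l}))))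
        = Xv i ^ a * g i * G V + (\<Sum>l\<in>?Q. ?t i l)"
      unfolding h1 distrib_left sum_distrib_left h2 h3 Cst_wsign_square by (simp only: mult_1)
  qed
  moreover have "dwedge n g (contract n a G) V = (\<Sum>l\<in>?Q. Xv l ^ a * g l * G V - (\<Sum>i\<in>?P. ?t i l))"
    unfolding contract_def dwedge_def
  proof (intro sum.cong refl)
    fix l assume l: "l \<in> ?Q"
    have ins: "insert l (V - {l}) = V" using l by auto
    have "{..<n} - (V - {l}) = insert l ?P" "l \<notin> ?P" using l by auto
    then have h1: "(\<Sum>i\<in>{..<n} - (V - {l}). Cst (wsign {i} (V - {l})) * (Xv i ^ a * G (insert i (V - {l}))))
      = Cst (wsign {l} (V - {l})) * (Xv l ^ a * G V)
        + (\<Sum>i\<in>?P. Cst (wsign {i} (V - {l})) * (Xv i ^ a * G (insert i (V - {l}))))"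
      using ins by simp
    have h2: "Cst (wsign {l} (V - {l})) * (g l * (Cst (wsign {l} (V - {l})) * (Xv l ^ a * G V)))
       = (Cst (wsign {l} (V - {l})) * Cst (wsign {l} (V - {l}))) * (Xv l ^ a * g l * G V)" by (simp only: mult_ac)
    have "Cst (wsign {l} (V - {l})) * (g l * (Cst (wsign {i} (V - {l})) * (Xv i ^ a * G (insert i (V - {l})))))
        = - ?t i l" if i: "i \<in> ?P" for i
    proof -
      have e: "insert i V - {l} = insert i (V - {l})" and ne: "i \<noteq> l" using i l by auto
      \<comment> \<open>Exactly one of l < i and i < l holds, so the two orders of i and l differ by
        one sign.\<close>
      have "wsign {i} V = wsign {i} (V - {l}) * (if l < i then -1 else 1)"
        using wsign_singleton_insert[of l "V - {l}" i] ins by simp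
      moreover have "wsign {l} (insert i V - {l}) = wsign {l} (V - {l}) * (if i < l then -1 else 1)"
        unfolding e using i by (subst wsign_singleton_insert) auto
      ultimately have "wsign {i} V * wsign {l} (insert i V - {l}) = - (wsign {l} (V - {l}) * wsign {i} (V - {l}))"
        using ne by auto
      then have "?t i l = - ((Cst (wsign {l} (V - {l})) * Cst (wsign {i} (V - {l}))) * (Xv i ^ a * (g l * G (insert i V - {l}))))"
        by (simp add: mult_single single_uminus)
      then show ?thesis unfolding e by (simp only: mult_ac minus_minus)
    qed
    then have h3: "(\<Sum>i\<in>?P. Cst (wsign {l} (V - {l})) * (g l * (Cst (wsign {i} (V - {l})) * (Xv i ^ a * G (insert i (V - {l}))))))
        = - (\<Sum>i\<in>?P. ?t i l)"
      unfolding sum_negf[symmetric] by (rule sum.cong[OF refl])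
    show "Cst (wsign {l} (V - {l})) * (g l * (\<Sum>i\<in>{..<n} - (V - {l}). Cst (wsign {i} (V - {l})) * (Xv i ^ a * G (insert i (V - {l})))))
        = Xv l ^ a * g l * G V - (\<Sum>i\<in>?P. ?t i l)"
      unfolding h1 distrib_left sum_distrib_left h2 h3 Cst_wsign_square by (simp only: mult_1 diff_conv_add_uminus)
  qed
  moreover have "(\<Sum>i\<in>?P. \<Sum>l\<in>?Q. ?t i l) = (\<Sum>l\<in>?Q. \<Sum>i\<in>?P. ?t i l)" by (rule sum.swap)
  moreover have "(\<Sum>i<n. Xv i ^ a * g i * G V) = (\<Sum>i\<in>?P. Xv i ^ a * g i * G V) + (\<Sum>i\<in>?Q. Xv i ^ a * g i * G V)"
    by (subst sum.union_disjoint[symmetric]) (auto intro: sum.cong)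
  ultimately show ?thesis by (simp add: sum.distrib sum_subtractf sum_distrib_right)
qed

lemma contract_mult: "contract n a (\<lambda>V. h * G V) = (\<lambda>V. h * contract n a G V)"
  by (simp add: contract_def sum_distrib_left mult_ac fun_eq_iff)

lemma contract_add: "contract n a (\<lambda>V. F V + G V) = (\<lambda>V. contract n a F V + contract n a G V)"
  by (simp add: contract_def distrib_left sum.distrib fun_eq_iff)

text \<open>All power sums are admitted here, since contraction raises their index.\<close>
inductive_set Nfam :: "nat \<Rightarrow> (nat set \<Rightarrow> cpoly) set" for n where
  powsum: "1 \<le> j \<Longrightarrow> (\<lambda>V. powsum n j * G V) \<in> Nfam n"
| dpow: "1 \<le> j \<Longrightarrow> dwedge n (\<lambda>i. Xv i ^ (j - 1)) G \<in> Nfam n"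
| add: "F \<in> Nfam n \<Longrightarrow> G \<in> Nfam n \<Longrightarrow> (\<lambda>V. F V + G V) \<in> Nfam n"

text \<open>By anticommutation, contracting a wedge with dp_j leaves a multiple of the power sum of
  index a + j - 1 and another wedge with dp_j. The index is positive since a is.\<close>

lemma contract_Nfam: 
  assumes "F \<in> Nfam n" "1 \<le> a" shows "contract n a F \<in> Nfam n"
  using assms(1)
proof (induction rule: Nfam.induct)
  case (powsum j G)
  then show ?case by (simp add: contract_mult Nfam.powsum)
next
  case (dpow j G)
  let ?g = "\<lambda>i. Xv i ^ (j - 1)"
  have "(\<Sum>i<n. Xv i ^ a * ?g i) = powsum n (a + (j - 1))" by (simp add: powsum_def power_add)
  then have "contract n a (dwedge n ?g G) V + dwedge n ?g (contract n a G) V = powsum n (a + (j - 1)) * G V" for V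
    using contract_dwedge[of n a ?g G V] by simp
  then have "contract n a (dwedge n ?g G)
     = (\<lambda>V. powsum n (a + (j - 1)) * G V + dwedge n ?g (\<lambda>V. (-1) * contract n a G V) V)"
    unfolding dwedge_mult_right by (simp add: fun_eq_iff eq_diff_eq)
  moreover have "(\<lambda>V. powsum n (a + (j - 1)) * G V + dwedge n ?g (\<lambda>V. (-1) * contract n a G V) V) \<in> Nfam n"
    using dpow assms(2) by (intro Nfam.intros) auto
  ultimately show ?case by simp
qed (auto simp: contract_add intro: Nfam.add)

text \<open>The largest exponent is contracted first, which suits the induction in
  \<open>lam_contracts_monomial\<close>.\<close>

primrec contracts :: "nat \<Rightarrow> nat \<Rightarrow> (nat set \<Rightarrow> cpoly) \<Rightarrow> nat set \<Rightarrow> cpoly" where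
  "contracts n 0 F = F"
| "contracts n (Suc k) F = contracts n k (contract n (Suc k) F)"

lemma contracts_Nfam: "F \<in> Nfam n \<Longrightarrow> contracts n k F \<in> Nfam n"
  by (induction k arbitrary: F) (simp_all add: contract_Nfam)

lemma contracts_mult: "contracts n k (\<lambda>V. h * G V) = (\<lambda>V. h * contracts n k G V)"
  by (induction k arbitrary: G) (auto simp: contract_mult)

lemma contracts_add: "contracts n k (\<lambda>V. F V + G V) = (\<lambda>V. contracts n k F V + contracts n k G V)"
  by (induction k arbitrary: F G) (auto simp: contract_add)

lemma contract_0: "contract n a (\<lambda>V. 0) = (\<lambda>V. 0)"
  by (simp add: contract_def fun_eq_iff)

lemma contracts_0: "contracts n k (\<lambda>V. 0) = (\<lambda>V. 0)"
  by (induction k) (auto simp: contract_0)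

lemma contracts_sum: "contracts n k (\<lambda>V. \<Sum>a\<in>A. F a V) = (\<lambda>V. \<Sum>a\<in>A. contracts n k (F a) V)"
  by (induction A rule: infinite_finite_induct) (auto simp: contracts_0 contracts_add)

text \<open>Ties count as increasing.\<close>
definition inv_sign :: "nat \<Rightarrow> (nat \<Rightarrow> nat) \<Rightarrow> complex" where
  "inv_sign n f = (\<Prod>b<n. \<Prod>a<b. if f b < f a then -1 else 1)"

lemma inv_sign_nonzero: "inv_sign n f \<noteq> 0"
  by (simp add: inv_sign_def)

text \<open>Only comparisons with position i are affected by the change; c p records the factor by
  which the comparison with p changes.\<close>

lemma inv_sign_update:
  fixes c :: "nat \<Rightarrow> complex"
  assumes "i < n"
    "\<And>p. i < p \<Longrightarrow> p < n \<Longrightarrow> (if f p < y then -1 else 1) = (if f p < f i then -1 else 1) * c p"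
    "\<And>p. p < i \<Longrightarrow> (if y < f p then -1 else 1) = (if f i < f p then -1 else 1) * c p"
  shows "inv_sign n (f(i := y)) = inv_sign n f * (\<Prod>p\<in>{..<n} - {i}. c p)"
proof -
  let ?d = "\<lambda>a b. if a = i then c b else if b = i then c a else 1"
  have "inv_sign n (f(i := y)) = (\<Prod>b<n. \<Prod>a<b. (if f b < f a then -1 else 1) * ?d a b)"
    unfolding inv_sign_def
  proof (intro prod.cong refl)
    fix b a assume "b \<in> {..<n}" "a \<in> {..<b}"
    then have ab: "b < n" "a < b" by auto
    show "(if (f(i := y)) b < (f(i := y)) a then -1 else 1) = (if f b < f a then -1 else 1) * ?d a b"
    proof (cases "a = i")
      case True
      then have "(f(i := y)) b = f b" "(f(i := y)) a = y" using ab by auto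
      then show ?thesis using assms(2)[of b] ab True by (simp only: if_True simp_thms)
    next
      case a: False
      show ?thesis
      proof (cases "b = i")
        case True
        then have "(f(i := y)) b = y" "(f(i := y)) a = f a" using a by auto
        then show ?thesis using assms(3)[of a] ab True a by (simp only: if_True if_False simp_thms)
      qed (use a in simp)
    qed
  qed
  also have "\<dots> = inv_sign n f * (\<Prod>b<n. \<Prod>a<b. ?d a b)"
    by (simp add: inv_sign_def prod.distrib)
  also have "(\<Prod>b<n. \<Prod>a<b. ?d a b) = (\<Prod>b<n. if b = i then (\<Prod>a<i. c a) else if i < b then c b else 1)"
  proof (intro prod.cong refl)
    fix b assume "b \<in> {..<n}"
    show "(\<Prod>a<b. ?d a b) = (if b = i then (\<Prod>a<i. c a) else if i < b then c b else 1)"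
    proof (cases "b = i")
      case False
      then have "(\<Prod>a<b. ?d a b) = (\<Prod>a<b. if a = i then c b else 1)" by (simp only: if_False)
      also have "\<dots> = (if i < b then c b else 1)" by (simp add: prod.delta)
      finally show ?thesis using False by (simp only: if_False)
    qed (auto intro: prod.cong)
  qed
  also have "\<dots> = (\<Prod>a<i. c a) * (\<Prod>b\<in>{..<n} - {i}. if i < b then c b else 1)"
  proof -
    have "(\<Prod>b<n. if b = i then (\<Prod>a<i. c a) else if i < b then c b else 1)
        = (\<Prod>a<i. c a) * (\<Prod>b\<in>{..<n} - {i}. if b = i then (\<Prod>a<i. c a) else if i < b then c b else 1)"
      using assms(1) by (subst prod.remove[of _ i]) simp_all
    also have "(\<Prod>b\<in>{..<n} - {i}. if b = i then (\<Prod>a<i. c a) else if i < b then c b else 1)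
        = (\<Prod>b\<in>{..<n} - {i}. if i < b then c b else 1)"
      by (rule prod.cong) auto
    finally show ?thesis .
  qed
  also have "(\<Prod>b\<in>{..<n} - {i}. if i < b then c b else 1) = (\<Prod>b\<in>{i<..<n}. c b)"
    by (intro prod.mono_neutral_cong_right) auto
  also have "(\<Prod>a<i. c a) * (\<Prod>b\<in>{i<..<n}. c b) = (\<Prod>p\<in>{..<n} - {i}. c p)"
    using assms(1) by (subst prod.union_disjoint[symmetric]) (auto intro: prod.cong)
  finally show ?thesis .
qed

text \<open>Raising either of the tied values crosses the same values strictly between w and w + j.
  The only difference is the pair itself: raising the earlier position creates an inversion, raising
  the later one does not.\<close>

lemma inv_sign_swap:
  assumes "a < b" "b < n" "f a = w" "f b = w" "0 < j"
    "\<And>p. p < n \<Longrightarrow> p \<noteq> a \<Longrightarrow> p \<noteq> b \<Longrightarrow> f p \<noteq> w \<and> f p \<noteq> w + j"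
  shows "inv_sign n (f(a := w + j)) = - inv_sign n (f(b := w + j))"
proof -
  let ?B = "\<lambda>p. if w < f p \<and> f p < w + j then -1 else (1::complex)"
  have ne: "p < n \<Longrightarrow> p \<noteq> a \<Longrightarrow> p \<noteq> b \<Longrightarrow> f p < w \<or> (w < f p \<and> f p < w + j) \<or> w + j < f p" for p
    using assms(6)[of p] by linarith
  have "inv_sign n (f(a := w + j)) = inv_sign n f * (\<Prod>p\<in>{..<n} - {a}. if p = b then -1 else ?B p)"
  proof (rule inv_sign_update)
    fix p assume "a < p" "p < n"
    then show "(if f p < w + j then -1 else 1) = (if f p < f a then -1 else 1) * (if p = b then -1 else ?B p)"
      using ne[of p] assms(3-5) by (cases "p = b") auto
  next
    fix p assume "p < a"
    then show "(if w + j < f p then -1 else 1) = (if f a < f p then -1 else 1) * (if p = b then -1 else ?B p)"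
      using ne[of p] assms(1-5) by auto
  qed (use assms in auto)
  moreover have "inv_sign n (f(b := w + j)) = inv_sign n f * (\<Prod>p\<in>{..<n} - {b}. if p = a then 1 else ?B p)"
  proof (rule inv_sign_update)
    fix p assume "b < p" "p < n"
    then show "(if f p < w + j then -1 else 1) = (if f p < f b then -1 else 1) * (if p = a then 1 else ?B p)"
      using ne[of p] assms(1-5) by auto
  next
    fix p assume "p < b"
    then show "(if w + j < f p then -1 else 1) = (if f b < f p then -1 else 1) * (if p = a then 1 else ?B p)"
      using ne[of p] assms(1-5) by (cases "p = a") auto
  qed (use assms in auto)
  moreover have "(\<Prod>p\<in>{..<n} - {a}. if p = b then -1 else ?B p) = - (\<Prod>p\<in>{..<n} - {a} - {b}. ?B p)"
    using assms(1,2) by (subst prod.remove[of _ b]) (auto intro!: prod.cong)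
  moreover have "(\<Prod>p\<in>{..<n} - {b}. if p = a then 1 else ?B p) = (\<Prod>p\<in>{..<n} - {a} - {b}. ?B p)"
    using assms(1,2) by (subst prod.remove[of _ a]) (auto intro!: prod.cong)
  ultimately show ?thesis by simp
qed

definition eps :: "nat \<Rightarrow> (nat \<Rightarrow>\<^sub>0 nat) \<Rightarrow> complex" where
  "eps n m = (if Poly_Mapping.lookup m ` {..<n} = {..<n} then inv_sign n (Poly_Mapping.lookup m) else 0)"

lemma lookup_add_single: "Poly_Mapping.lookup (m + Poly_Mapping.single i j) = (Poly_Mapping.lookup m)(i := Poly_Mapping.lookup m i + j)"
  by (auto simp: lookup_add lookup_single when_def fun_eq_iff)

text \<open>If adding \<open>j\<close> at position \<open>i\<close> gives a rearrangement of \<open>0, \<dots>, n-1\<close>, then the old value at \<open>i\<close> occurs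
  at exactly one other position, and adding \<open>j\<close> there gives a rearrangement of opposite sign.\<close>
lemma eps_shift_sum:
  assumes "0 < j" shows "(\<Sum>i<n. eps n (m + Poly_Mapping.single i j)) = 0"
proof (cases "\<exists>i<n. eps n (m + Poly_Mapping.single i j) \<noteq> 0")
  case False
  then show ?thesis by (intro sum.neutral) auto
next
  case True
  define f where "f = Poly_Mapping.lookup m"
  have eps: "eps n (m + Poly_Mapping.single i j)
      = (if (f(i := f i + j)) ` {..<n} = {..<n} then inv_sign n (f(i := f i + j)) else 0)" for i
    unfolding eps_def lookup_add_single f_def ..
  obtain i where i: "i < n" "(f(i := f i + j)) ` {..<n} = {..<n}"
    using True unfolding eps by (metis (full_types))
  let ?w = "f i" let ?fi = "f(i := ?w + j)"
  have inj: "inj_on ?fi {..<n}" using i(2) by (intro eq_card_imp_inj_on) auto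
  have "?w + j \<in> {..<n}" using i by (metis fun_upd_same imageI lessThan_iff)
  then have "?w \<in> ?fi ` {..<n}" unfolding i(2) by simp
  then obtain k where k: "k < n" "?fi k = ?w" by auto
  then have ki: "k \<noteq> i" "f k = ?w" using assms by (auto split: if_splits)
  have ne: "f p \<noteq> ?w \<and> f p \<noteq> ?w + j" if "p < n" "p \<noteq> i" "p \<noteq> k" for p
  proof -
    have "?fi p \<noteq> ?fi k" "?fi p \<noteq> ?fi i" using inj that k(1) i(1) unfolding inj_on_def by blast+
    then show ?thesis using that ki by simp
  qed
  \<comment> \<open>Raising any other position leaves the tie between i and k, so the values are not
    distinct.\<close>
  have other: "eps n (m + Poly_Mapping.single p j) = 0" if "p < n" "p \<noteq> i" "p \<noteq> k" for p
  proof -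
    have "(f(p := f p + j)) ` {..<n} \<noteq> {..<n}"
    proof
      assume "(f(p := f p + j)) ` {..<n} = {..<n}"
      then have "inj_on (f(p := f p + j)) {..<n}" by (intro eq_card_imp_inj_on) auto
      moreover have "(f(p := f p + j)) i = (f(p := f p + j)) k" using that ki by simp
      ultimately show False using i(1) k(1) ki(1) unfolding inj_on_def by blast
    qed
    then show ?thesis unfolding eps by simp
  qed
  have split: "g ` {..<n} = {g i, g k} \<union> g ` ({..<n} - {i, k})" for g :: "nat \<Rightarrow> nat"
    using i(1) k(1) by auto
  have "(f(k := ?w + j)) ` ({..<n} - {i, k}) = ?fi ` ({..<n} - {i, k})"
    by (intro image_cong) auto
  then have im: "(f(k := f k + j)) ` {..<n} = {..<n}"
    using split[of "f(k := ?w + j)"] split[of ?fi] ki i(2) by (simp add: insert_commute)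
  have "(\<Sum>p<n. eps n (m + Poly_Mapping.single p j))
      = (\<Sum>p\<in>{i, k}. eps n (m + Poly_Mapping.single p j))"
    using i k other by (intro sum.mono_neutral_right) auto
  also have "\<dots> = inv_sign n (f(i := ?w + j)) + inv_sign n (f(k := ?w + j))"
    using ki i im by (simp add: eps)
  also have "\<dots> = 0"
  proof (cases "i < k")
    case True
    then show ?thesis using inv_sign_swap[of i k n f ?w j] k ki assms ne by simp
  next
    case False
    then have "k < i" using ki by simp
    then show ?thesis using inv_sign_swap[of k i n f ?w j] i ki assms ne by simp
  qed
  finally show ?thesis .
qed


section \<open>The alternating functional\<close>

text \<open>On polynomials in x_0, ..., x_{n-1} this pairs the coefficients of f with those of the
  Vandermonde product of all x_b - x_a with a < b.\<close>

definition lam :: "nat \<Rightarrow> cpoly \<Rightarrow> complex" where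
  "lam n f = (\<Sum>m\<in>Poly_Mapping.keys f. Poly_Mapping.lookup f m * eps n m)"

lemma lam_superset:
  assumes "finite A" "Poly_Mapping.keys f \<subseteq> A"
  shows "lam n f = (\<Sum>m\<in>A. Poly_Mapping.lookup f m * eps n m)"
  unfolding lam_def using assms by (intro sum.mono_neutral_left) (auto simp: in_keys_iff)

lemma lam_single: "lam n (Poly_Mapping.single m c) = c * eps n m"
  by (subst lam_superset[of "{m}"]) auto

lemma lam_add: "lam n (f + g) = lam n f + lam n g"
proof -
  let ?A = "Poly_Mapping.keys f \<union> Poly_Mapping.keys g"
  show ?thesis
    using keys_add[of f g] by (simp add: lam_superset[of ?A] lookup_add distrib_right sum.distrib)
qed

lemma lam_0 [simp]: "lam n 0 = 0"
  by (simp add: lam_def)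

lemma lam_sum: "lam n (sum f A) = (\<Sum>a\<in>A. lam n (f a))"
  by (induction A rule: infinite_finite_induct) (auto simp: lam_add)

lemma lam_Cst_mult: "lam n (Cst c * f) = c * lam n f"
  by (induction f rule: cpoly_induct) (auto simp: mult_single lam_single lam_add distrib_left)

lemma lam_powsum_mult:
  assumes "1 \<le> j" shows "lam n (powsum n j * f) = 0"
proof (induction f rule: cpoly_induct)
  case (single m c)
  have "powsum n j * Poly_Mapping.single m c = (\<Sum>i<n. Poly_Mapping.single (m + Poly_Mapping.single i j) c)"
    by (simp add: powsum_def X_power sum_distrib_right mult_single add.commute)
  then have "lam n (powsum n j * Poly_Mapping.single m c) = c * (\<Sum>i<n. eps n (m + Poly_Mapping.single i j))"
    by (simp only: lam_sum lam_single sum_distrib_left)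
  then show ?case using eps_shift_sum[of j n m] assms by simp
qed (simp add: distrib_left lam_add)

text \<open>A wedge with a one-form has no component at the empty set, so only multiples of power
  sums remain.\<close>

lemma lam_Nfam: "F \<in> Nfam n \<Longrightarrow> lam n (F {}) = 0"
  by (induction rule: Nfam.induct) (auto simp: lam_powsum_mult lam_add dwedge_def)

lemma contract_unitf:
  assumes "U \<subseteq> {..<n}"
  shows "contract n a (unitf U f)
    = (\<lambda>V. \<Sum>i\<in>U. Cst (wsign {i} (U - {i})) * unitf (U - {i}) (Xv i ^ a * f) V)"
proof
  fix V
  have "contract n a (unitf U f) V
      = (\<Sum>i\<in>{..<n} - V. if insert i V = U then Cst (wsign {i} V) * (Xv i ^ a * f) else 0)"
    unfolding contract_def unitf_def by (intro sum.cong refl) simp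
  also have "\<dots> = (\<Sum>i\<in>{..<n}. if i \<in> U \<and> V = U - {i} then Cst (wsign {i} V) * (Xv i ^ a * f) else 0)"
    using assms by (intro sum.mono_neutral_cong_left) auto
  also have "\<dots> = (\<Sum>i\<in>U. if V = U - {i} then Cst (wsign {i} V) * (Xv i ^ a * f) else 0)"
    using assms by (intro sum.mono_neutral_cong_right) auto
  also have "\<dots> = (\<Sum>i\<in>U. Cst (wsign {i} (U - {i})) * unitf (U - {i}) (Xv i ^ a * f) V)"
    by (intro sum.cong refl) (simp add: unitf_def)
  finally show "contract n a (unitf U f) V
    = (\<Sum>i\<in>U. Cst (wsign {i} (U - {i})) * unitf (U - {i}) (Xv i ^ a * f) V)" .
qed

lemma prod_minus_one_if:
  "finite A \<Longrightarrow> (\<Prod>p\<in>A. if P p then -1 else (1::complex)) = (-1) ^ card {p \<in> A. P p}"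
proof (induction A rule: finite_induct)
  case (insert a A)
  have "{p \<in> insert a A. P p} = (if P a then insert a {p \<in> A. P p} else {p \<in> A. P p})" by auto
  then show ?case using insert by simp
qed simp

text \<open>The positions in \<open>U\<close> still have to receive the exponents \<open>1, \<dots>, r\<close>; all other exponents are 0 or
  larger than \<open>r\<close>, so for their relative order to \<open>U\<close> every position in \<open>U\<close> may be given the value 1.\<close>
lemma lam_contracts_monomial:
  assumes "U \<subseteq> {..<n}" "card U = r" "r < n" "\<And>u. u \<in> U \<Longrightarrow> Poly_Mapping.lookup m u = 0"
    "Poly_Mapping.lookup m ` ({..<n} - U) = insert 0 {r<..<n}"
  shows "lam n (contracts n r (unitf U (Poly_Mapping.single m 1)) {})
    = fact r * (-1) ^ (r choose 2) * inv_sign n (\<lambda>p. if p \<in> U then 1 else Poly_Mapping.lookup m p)"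
  using assms
proof (induction r arbitrary: U m)
  case 0
  have "finite U" using 0(1) finite_subset by blast
  then have "U = {}" using 0 by simp
  moreover have "insert 0 {0<..<n} = {..<n}" using 0 by auto
  ultimately show ?case using 0 by (simp add: unitf_def lam_single eps_def numeral_2_eq_2)
next
  case (Suc r)
  have fin: "finite U" using Suc.prems(1) finite_subset by blast
  let ?fill = "\<lambda>p. if p \<in> U then 1 else Poly_Mapping.lookup m p"
  let ?m = "\<lambda>i. m + Poly_Mapping.single i (Suc r)"
  \<comment> \<open>Contraction at i gives position i the exponent r + 1; all elements of U turn out
    to contribute equally.\<close>
  have term_i: "wsign {i} (U - {i}) * lam n (contracts n r (unitf (U - {i}) (Xv i ^ Suc r * Poly_Mapping.single m 1)) {})
      = (-1) ^ r * (fact r * (-1) ^ (r choose 2) * inv_sign n ?fill)" if i: "i \<in> U" for i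
  proof -
    have m: "Xv i ^ Suc r * Poly_Mapping.single m 1 = Poly_Mapping.single (?m i) 1"
      unfolding X_power by (simp add: mult_single add.commute)
    have IH: "lam n (contracts n r (unitf (U - {i}) (Poly_Mapping.single (?m i) 1)) {})
      = fact r * (-1) ^ (r choose 2) * inv_sign n (\<lambda>p. if p \<in> U - {i} then 1 else Poly_Mapping.lookup (?m i) p)"
    proof (rule Suc.IH)
      show "U - {i} \<subseteq> {..<n}" using Suc.prems(1) by blast
      show "card (U - {i}) = r" using Suc.prems(2) i fin by simp
      show "r < n" using Suc.prems(3) by simp
      show "Poly_Mapping.lookup (?m i) u = 0" if "u \<in> U - {i}" for u
        using that Suc.prems(4)[of u] by (simp add: lookup_add_single)
      have "{..<n} - (U - {i}) = insert i ({..<n} - U)" using i Suc.prems(1) by blast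
      moreover have lk: "Poly_Mapping.lookup (?m i) i = Suc r"
        using Suc.prems(4)[OF i] by (simp add: lookup_add_single)
      moreover have "Poly_Mapping.lookup (?m i) ` ({..<n} - U) = Poly_Mapping.lookup m ` ({..<n} - U)"
        using i by (intro image_cong) (auto simp: lookup_add_single)
      ultimately have "Poly_Mapping.lookup (?m i) ` ({..<n} - (U - {i})) = insert (Suc r) (insert 0 {Suc r<..<n})"
        using Suc.prems(5) lk by (simp only: image_insert)
      also have "\<dots> = insert 0 {r<..<n}" using Suc.prems(3) by auto
      finally show "Poly_Mapping.lookup (?m i) ` ({..<n} - (U - {i})) = insert 0 {r<..<n}" .
    qed
    have upd: "(\<lambda>p. if p \<in> U - {i} then 1 else Poly_Mapping.lookup (?m i) p) = ?fill(i := Suc r)"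
      using i Suc.prems(4)[OF i] by (auto simp: lookup_add_single fun_eq_iff)
    have off: "Poly_Mapping.lookup m p = 0 \<or> Suc r < Poly_Mapping.lookup m p" if "p < n" "p \<notin> U" for p
    proof -
      have "Poly_Mapping.lookup m p \<in> insert 0 {Suc r<..<n}"
        using Suc.prems(5) that by blast
      then show ?thesis by auto
    qed
    \<comment> \<open>With a second element in U, its filled-in value 1 is strictly below the new
      value \<open>Suc r\<close>.\<close>
    have many: "r > 0" if "p \<in> U" "p \<noteq> i" for p
    proof -
      have "card {p, i} \<le> card U" using that i by (intro card_mono fin) auto
      then show ?thesis using that Suc.prems(2) by simp
    qed
    \<comment> \<open>Replacing 1 by r + 1 at i creates inversions with the later positions of U
      only.\<close>
    have "inv_sign n (?fill(i := Suc r)) = inv_sign n ?fill * (\<Prod>p\<in>{..<n} - {i}. if p \<in> U \<and> i < p then -1 else 1)"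
    proof (rule inv_sign_update)
      show "i < n" using i Suc.prems(1) by blast
    next
      fix p assume p: "i < p" "p < n"
      show "(if ?fill p < Suc r then -1 else 1)
        = (if ?fill p < ?fill i then -1 else 1) * (if p \<in> U \<and> i < p then -1 else (1::complex))"
        using p i many[of p] off[of p] by (cases "p \<in> U") auto
    next
      fix p assume p: "p < i"
      then have "p < n" using i Suc.prems(1) by (meson lessThan_iff less_trans subsetD)
      then show "(if Suc r < ?fill p then -1 else 1)
        = (if ?fill i < ?fill p then -1 else 1) * (if p \<in> U \<and> i < p then -1 else (1::complex))"
        using p i many[of p] off[of p] by (cases "p \<in> U") auto
    qed
    moreover have "{p \<in> {..<n} - {i}. p \<in> U \<and> i < p} = {p \<in> U. i < p}" using Suc.prems(1) by auto
    ultimately have inv: "inv_sign n (?fill(i := Suc r)) = inv_sign n ?fill * (-1) ^ card {p \<in> U. i < p}"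
      by (simp add: prod_minus_one_if)
    have "U - {i} = {j \<in> U - {i}. j < i} \<union> {p \<in> U. i < p}"
    proof (rule set_eqI)
      fix x show "x \<in> U - {i} \<longleftrightarrow> x \<in> {j \<in> U - {i}. j < i} \<union> {p \<in> U. i < p}"
        by (cases x i rule: linorder_cases) auto
    qed
    then have "card (U - {i}) = card ({j \<in> U - {i}. j < i} \<union> {p \<in> U. i < p})" by (rule arg_cong)
    also have "\<dots> = card {j \<in> U - {i}. j < i} + card {p \<in> U. i < p}"
      using fin by (intro card_Un_disjoint) auto
    finally have r: "card {j \<in> U - {i}. j < i} + card {p \<in> U. i < p} = r"
      using Suc.prems(2) i fin by simp
    \<comment> \<open>The sign of the contraction counts the earlier elements of U, the inversions
      count the later ones; together they give r for every i.\<close>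
    have sgn: "wsign {i} (U - {i}) * (-1) ^ card {p \<in> U. i < p} = (-1) ^ r"
      unfolding wsign_singleton power_add[symmetric] r ..
    have "wsign {i} (U - {i}) * lam n (contracts n r (unitf (U - {i}) (Xv i ^ Suc r * Poly_Mapping.single m 1)) {})
      = (wsign {i} (U - {i}) * (-1) ^ card {p \<in> U. i < p}) * (fact r * (-1) ^ (r choose 2) * inv_sign n ?fill)"
      unfolding m IH upd inv by (simp only: mult_ac)
    then show ?thesis unfolding sgn .
  qed
  have "lam n (contracts n (Suc r) (unitf U (Poly_Mapping.single m 1)) {})
    = (\<Sum>i\<in>U. wsign {i} (U - {i}) * lam n (contracts n r (unitf (U - {i}) (Xv i ^ Suc r * Poly_Mapping.single m 1)) {}))"
    unfolding contracts.simps contract_unitf[OF Suc.prems(1)] contracts_sum contracts_mult lam_sum lam_Cst_mult ..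
  \<comment> \<open>The r + 1 equal terms add up without cancellation.\<close>
  also have "\<dots> = of_nat (Suc r) * ((-1) ^ r * (fact r * (-1) ^ (r choose 2) * inv_sign n ?fill))"
    using term_i Suc.prems(2) by simp
  also have "\<dots> = fact (Suc r) * (-1) ^ (Suc r choose 2) * inv_sign n ?fill"
    by (simp add: numeral_2_eq_2 power_add algebra_simps)
  finally show ?case .
qed

section \<open>Moving the generators to the left of a product\<close>

lemma fwedge_infinite: "infinite V \<Longrightarrow> fwedge F G V = 0"
  by (simp add: fwedge_def)

lemma fwedge_unitf_empty_right:
  assumes "\<And>V. infinite V \<Longrightarrow> F V = 0"
  shows "fwedge F (unitf {} f) = (\<lambda>V. f * F V)"
proof
  fix V
  show "fwedge F (unitf {} f) V = f * F V"
  proof (cases "finite V")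
    case True
    have "fwedge F (unitf {} f) V = (\<Sum>S\<in>Pow V. if S = V then f * F V else 0)"
      unfolding fwedge_def by (intro sum.cong refl) (auto simp: unitf_def)
    then show ?thesis using True by (simp add: sum.delta)
  qed (simp add: fwedge_def assms)
qed

lemma fwedge_mult_left: "fwedge (\<lambda>V. h * F V) G = (\<lambda>V. h * fwedge F G V)"
  by (simp add: fwedge_def sum_distrib_left mult_ac fun_eq_iff)

text \<open>Moving a one-form past dx_S costs (-1)^|S|.\<close>

lemma fwedge_oneform_right:
  assumes "\<And>V. infinite V \<Longrightarrow> F V = 0"
  shows "fwedge F (oneform n g) = dwedge n g (\<lambda>S. Cst ((-1) ^ card S) * F S)"
proof
  fix V
  show "fwedge F (oneform n g) V = dwedge n g (\<lambda>S. Cst ((-1) ^ card S) * F S) V"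
  proof (cases "finite V")
    case True
    have "fwedge F (oneform n g) V
       = (\<Sum>S\<in>Pow V. \<Sum>i<n. if i \<in> V \<and> S = V - {i} then Cst (wsign (V - {i}) {i}) * (F (V - {i}) * g i) else 0)"
      unfolding fwedge_def oneform_def sum_distrib_left
    proof (intro sum.cong refl)
      fix S i assume S: "S \<in> Pow V"
      have "V - S = {i} \<longleftrightarrow> i \<in> V \<and> S = V - {i}" using S by blast
      then show "Cst (wsign S (V - S)) * (F S * unitf {i} (g i) (V - S))
        = (if i \<in> V \<and> S = V - {i} then Cst (wsign (V - {i}) {i}) * (F (V - {i}) * g i) else 0)"
        by (auto simp: unitf_def)
    qed
    also have "\<dots> = (\<Sum>i<n. \<Sum>S\<in>Pow V. if i \<in> V \<and> S = V - {i} then Cst (wsign (V - {i}) {i}) * (F (V - {i}) * g i) else 0)"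
      by (rule sum.swap)
    also have "\<dots> = (\<Sum>i<n. if i \<in> V then Cst (wsign (V - {i}) {i}) * (F (V - {i}) * g i) else 0)"
    proof (intro sum.cong refl)
      fix i
      show "(\<Sum>S\<in>Pow V. if i \<in> V \<and> S = V - {i} then Cst (wsign (V - {i}) {i}) * (F (V - {i}) * g i) else 0)
        = (if i \<in> V then Cst (wsign (V - {i}) {i}) * (F (V - {i}) * g i) else 0)"
        using True by (cases "i \<in> V") (auto simp: sum.delta)
    qed
    also have "\<dots> = (\<Sum>i\<in>V \<inter> {..<n}. Cst (wsign (V - {i}) {i}) * (F (V - {i}) * g i))"
      by (subst sum.inter_restrict[symmetric]) (auto simp: Int_commute)
    also have "\<dots> = dwedge n g (\<lambda>S. Cst ((-1) ^ card S) * F S) V"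
      unfolding dwedge_def
    proof (intro sum.cong refl)
      fix i assume "i \<in> V \<inter> {..<n}"
      have "wsign (V - {i}) {i} = (-1) ^ card (V - {i}) * wsign {i} (V - {i})"
        using True by (intro wsign_singleton_right) auto
      then have "Cst (wsign (V - {i}) {i}) = Cst ((-1) ^ card (V - {i})) * Cst (wsign {i} (V - {i}))"
        by (simp add: mult_single)
      then show "Cst (wsign (V - {i}) {i}) * (F (V - {i}) * g i)
        = Cst (wsign {i} (V - {i})) * (g i * (Cst ((-1) ^ card (V - {i})) * F (V - {i})))"
        by (simp only: mult_ac)
    qed
    finally show ?thesis .
  next
    case False
    have "dwedge n g (\<lambda>S. Cst ((-1) ^ card S) * F S) V = 0"
      unfolding dwedge_def using False by (intro sum.neutral) (auto simp: assms)
    then show ?thesis using False by (simp add: fwedge_def)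
  qed
qed

text \<open>Associativity of the wedge product: sets S containing i correspond to subsets T = S -
  {i} of V - {i}, and the signs agree by multiplicativity of \<open>wsign\<close>.\<close>

lemma fwedge_dwedge: "fwedge (dwedge n g F) G = dwedge n g (fwedge F G)"
proof
  fix V
  show "fwedge (dwedge n g F) G V = dwedge n g (fwedge F G) V"
  proof (cases "finite V")
    case False
    then have "dwedge n g (fwedge F G) V = 0"
      unfolding dwedge_def by (intro sum.neutral) (auto simp: fwedge_infinite)
    then show ?thesis using False by (simp add: fwedge_infinite)
  next
    case True
    let ?t = "\<lambda>S i. Cst (wsign S (V - S)) * (Cst (wsign {i} (S - {i})) * (g i * F (S - {i})) * G (V - S))"
    have "fwedge (dwedge n g F) G V = (\<Sum>S\<in>Pow V. \<Sum>i\<in>S \<inter> {..<n}. ?t S i)"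
      unfolding fwedge_def dwedge_def sum_distrib_right sum_distrib_left ..
    also have "\<dots> = (\<Sum>S\<in>Pow V. \<Sum>i\<in>V \<inter> {..<n}. if i \<in> S then ?t S i else 0)"
      using True by (intro sum.cong refl sum.mono_neutral_cong_left) auto
    also have "\<dots> = (\<Sum>i\<in>V \<inter> {..<n}. \<Sum>S\<in>Pow V. if i \<in> S then ?t S i else 0)"
      by (rule sum.swap)
    also have "\<dots> = dwedge n g (fwedge F G) V"
      unfolding dwedge_def
    proof (intro sum.cong refl)
      fix i assume i: "i \<in> V \<inter> {..<n}"
      have "(\<Sum>S\<in>Pow V. if i \<in> S then ?t S i else 0) = (\<Sum>S\<in>{S \<in> Pow V. i \<in> S}. ?t S i)"
        using True by (intro sum.mono_neutral_cong_right) auto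
      also have "\<dots> = (\<Sum>T\<in>Pow (V - {i}). Cst (wsign {i} (V - {i})) * (g i * (Cst (wsign T (V - {i} - T)) * (F T * G (V - {i} - T)))))"
      proof (rule sum.reindex_bij_witness[of _ "insert i" "\<lambda>S. S - {i}"])
        fix S assume S: "S \<in> {S \<in> Pow V. i \<in> S}"
        let ?T = "S - {i}" let ?W = "V - S"
        have fin: "finite ?T" "finite S" using S True finite_subset by auto
        have e: "V - {i} - ?T = ?W" "V - {i} = ?T \<union> ?W" "S = {i} \<union> ?T" using S i by auto
        have "wsign S ?W = wsign {i} ?W * wsign ?T ?W"
          using wsign_Un_left[of "{i}" ?T ?W] fin e(3) by auto
        moreover have "wsign {i} (V - {i}) = wsign {i} ?T * wsign {i} ?W"
          unfolding e(2) by (rule wsign_Un_right) auto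
        ultimately have "wsign S ?W * wsign {i} ?T = wsign {i} (V - {i}) * wsign ?T ?W" by simp
        then have c: "Cst (wsign S ?W) * Cst (wsign {i} ?T) = Cst (wsign {i} (V - {i})) * Cst (wsign ?T ?W)"
          by (simp add: mult_single)
        have "?t S i = (Cst (wsign S ?W) * Cst (wsign {i} ?T)) * (g i * (F ?T * G ?W))"
          by (simp only: mult_ac)
        also have "\<dots> = Cst (wsign {i} (V - {i})) * (g i * (Cst (wsign ?T ?W) * (F ?T * G ?W)))"
          unfolding c by (simp only: mult_ac)
        finally show "Cst (wsign {i} (V - {i})) * (g i * (Cst (wsign ?T (V - {i} - ?T)) * (F ?T * G (V - {i} - ?T)))) = ?t S i"
          unfolding e(1) ..
      qed (use i in auto)
      finally show "(\<Sum>S\<in>Pow V. if i \<in> S then ?t S i else 0)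
        = Cst (wsign {i} (V - {i})) * (g i * fwedge F G (V - {i}))"
        unfolding fwedge_def sum_distrib_left .
    qed
    finally show ?thesis .
  qed
qed

text \<open>In a two-sided product the generator is moved to the front; the sign (-1)^|S| and the
  other factors are absorbed into the family.\<close>

lemma Iideal_imp_Nfam:
  assumes "\<omega> \<in> Iideal n" shows "\<exists>F\<in>Nfam n. \<omega> = to_form F"
  using assms unfolding Iideal_def
proof (induction rule: gen_ideal.induct)
  case (gen g a b)
  obtain j where j: "1 \<le> j" "g = psum n j \<or> g = ext_d (psum n j)" using gen(1) by blast
  define A where "A = coeff_family a"
  define B where "B = coeff_family b"
  have ab: "a = to_form A" "b = to_form B" and AB: "A \<in> Families n" "B \<in> Families n"
    using to_form_coeff_family gen(2,3) by (auto simp: A_def B_def)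
  note inf = Families_infinite[OF AB(1)] Families_infinite[OF AB(2)]
  have W: "wedge (wedge a (to_form h)) b = to_form (fwedge (fwedge A h) B)"
    if "\<And>V. infinite V \<Longrightarrow> h V = 0" for h
    unfolding ab using inf that by (simp add: wedge_to_form fwedge_infinite)
  have unitf_infinite: "unitf {} f V = 0" if "infinite V" for f V
    using that by (auto simp: unitf_def)
  from j(2) show ?case
  proof
    assume "g = psum n j"
    then have "wedge (wedge a g) b = to_form (fwedge (fwedge A (unitf {} (powsum n j))) B)"
      using psum_eq_to_form[OF j(1)] W[of "unitf {} (powsum n j)"] unitf_infinite by simp
    moreover have "fwedge (fwedge A (unitf {} (powsum n j))) B = (\<lambda>V. powsum n j * fwedge A B V)"
      using inf(1) by (simp add: fwedge_unitf_empty_right fwedge_mult_left)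
    ultimately show ?thesis using Nfam.powsum[OF j(1)] by auto
  next
    assume "g = ext_d (psum n j)"
    moreover have "oneform n (dpow j) V = 0" if "infinite V" for V
      using that by (auto simp: oneform_def unitf_def intro!: sum.neutral)
    ultimately have "wedge (wedge a g) b = to_form (fwedge (fwedge A (oneform n (dpow j))) B)"
      using ext_d_psum_eq_to_form[OF j(1)] W[of "oneform n (dpow j)"] by simp
    moreover define C where "C = fwedge (\<lambda>S. Cst ((-1) ^ card S) * A S) B"
    have "fwedge (fwedge A (oneform n (dpow j))) B = dwedge n (dpow j) C"
      using inf(1) by (simp add: fwedge_oneform_right fwedge_dwedge C_def)
    \<comment> \<open>The factor j of dp_j is absorbed as well.\<close>
    moreover have "dwedge n (dpow j) C = dwedge n (\<lambda>i. Xv i ^ (j - 1)) (\<lambda>V. of_nat j * C V)"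
      unfolding dpow_def[abs_def] dwedge_mult[symmetric] by (simp only: mult.commute)
    ultimately show ?thesis using Nfam.dpow[OF j(1)] by auto
  qed
next
  case (add x y)
  then obtain F G where "F \<in> Nfam n" "x = to_form F" "G \<in> Nfam n" "y = to_form G" by blast
  moreover from this have "fadd x y = to_form (\<lambda>V. F V + G V)"
    by (auto simp: to_form_def fadd_def lookup_add)
  ultimately show ?case using Nfam.add by blast
qed

section \<open>The witness in the extremal degree\<close>

lemma sum_greaterThanLessThan_eq_choose:
  assumes "k < n" shows "(\<Sum>p\<in>{k<..<n}. p) = (n choose 2) - ((k + 1) choose 2)"
proof -
  have c: "(\<Sum>p<a. p) = a choose 2" for a :: nat
    by (induction a) (auto simp: numeral_2_eq_2)
  have "(\<Sum>p<n. p) = (\<Sum>p<k + 1. p) + (\<Sum>p\<in>{k<..<n}. p)"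
    using assms by (subst sum.union_disjoint[symmetric]) (auto intro: sum.cong)
  then show ?thesis unfolding c by simp
qed

lemma Omega_lk_not_subset_Iideal:
  assumes "k < n"
  shows "\<exists>\<omega>\<in>Omega_lk n ((n choose 2) - ((k + 1) choose 2)) k. \<omega> \<notin> Iideal n"
proof -
  \<comment> \<open>The positions above k carry their own index and position k carries 0, so the
    contractions, filling the positions below k with 1, ..., k, produce rearrangements of 0, ...,
    n-1.\<close>
  define m :: "nat \<Rightarrow>\<^sub>0 nat" where "m = (\<Sum>p\<in>{k<..<n}. Poly_Mapping.single p p)"
  have l: "Poly_Mapping.lookup m p = (if k < p \<and> p < n then p else 0)" for p
  proof -
    have "Poly_Mapping.lookup m p = (\<Sum>q\<in>{k<..<n}. if q = p then p else 0)"
      unfolding m_def lookup_sum by (intro sum.cong) (auto simp: lookup_single when_def)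
    then show ?thesis by (simp add: sum.delta)
  qed
  have keys: "Poly_Mapping.keys m \<subseteq> {k<..<n}"
    by (auto simp: in_keys_iff l split: if_splits)
  define F where "F = unitf {..<k} (Poly_Mapping.single m 1)"
  have FF: "F \<in> Families n"
    unfolding F_def using assms keys by (intro Families_unitf vars_in_single) auto
  have "mdeg m = (\<Sum>p\<in>{k<..<n}. p)"
    unfolding mdeg_eq_sum[OF keys finite_greaterThanLessThan] by (intro sum.cong) (auto simp: l)
  then have deg: "mdeg m = (n choose 2) - ((k + 1) choose 2)"
    using sum_greaterThanLessThan_eq_choose[OF assms] by simp
  have "mdeg m' = (n choose 2) - ((k + 1) choose 2) \<and> card S = k" if "to_form F (m', S) \<noteq> 0" for m' S
  proof -
    have "S = {..<k} \<and> m' = m"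
      using that by (auto simp: to_form_def F_def unitf_def lookup_single when_def split: if_splits)
    then show ?thesis using deg by simp
  qed
  then have "to_form F \<in> Omega_lk n ((n choose 2) - ((k + 1) choose 2)) k"
    unfolding Omega_lk_def using to_form_Omega[OF FF] by blast
  moreover have "to_form F \<notin> Iideal n"
  proof
    assume "to_form F \<in> Iideal n"
    then have "F \<in> Nfam n" using Iideal_imp_Nfam to_form_inject by metis
    then have "lam n (contracts n k F {}) = 0" by (intro lam_Nfam contracts_Nfam)
    moreover have "Poly_Mapping.lookup m ` ({..<n} - {..<k}) = insert 0 {k<..<n}"
    proof -
      have "{..<n} - {..<k} = insert k {k<..<n}" using assms by auto
      moreover have "Poly_Mapping.lookup m ` {k<..<n} = (\<lambda>p. p) ` {k<..<n}"
        by (intro image_cong) (auto simp: l)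
      moreover have "Poly_Mapping.lookup m k = 0" by (simp add: l)
      ultimately show ?thesis by (simp only: image_insert image_ident)
    qed
    then have "lam n (contracts n k F {}) = fact k * (-1) ^ (k choose 2)
        * inv_sign n (\<lambda>p. if p \<in> {..<k} then 1 else Poly_Mapping.lookup m p)"
      unfolding F_def using assms by (intro lam_contracts_monomial) (auto simp: l)
    ultimately show False using inv_sign_nonzero by simp
  qed
  ultimately show ?thesis by blast
qed

theorem theorem14:
  fixes n :: nat
  assumes "n \<ge> 1"
  shows "(\<forall>k l \<omega>. k \<le> n \<longrightarrow> \<omega> \<in> Omega_lk n l k \<longrightarrow>
            int l > int (n choose 2) - int ((k + 1) choose 2) \<longrightarrow> \<omega> \<in> Iideal n)
       \<and> (\<forall>k < n. \<exists>\<omega> \<in> Omega_lk n ((n choose 2) - ((k + 1) choose 2)) k. \<omega> \<notin> Iideal n)"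
  using Omega_lk_subset_Iideal[OF assms] Omega_lk_not_subset_Iideal by blast

end
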